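(* Consider the nonlinear vector autoregression, noise vector $\eta$ and empirical kernel matrix $\mathcal K(X,X)$ described in the context. Assume: (1) $\|g\|_\infty\le M_g$ for some $M_g\in(0,\infty)$. (2) For each $i=1,\dots,d$ there is $\kappa_i\in(0,\infty)$ with $\sup_{x\in\mathcal X^p}|K_i(x,x)|\le\kappa_i^2$. (3) There are eigenvalues $\lambda_{i,k}\ge0$ and eigenfunctions $\phi_{i,j,k}:\mathcal X^p\to\mathbb R$ ($i=1,\dots,d$; $k\in\mathbb N$; $j=1,\dots,N(k)$) with $\|\phi_{i,j,k}\|_\infty<\infty$ and $K_i(x,y)=\sum_{k=1}^{\infty}\lambda_{i,k}\sum_{j=1}^{N(k)}\phi_{i,j,k}(x)\phi_{i,j,k}(y)$ for all $x,y\in\mathcal X^p$, where $N(k)=\binom{k+dp-1}{dp-1}$. (4) There are $b_1\in(0,\infty)$, $b_2\in\mathbb R$ such that, with $\beta_{i,j,k}=\lambda_{i,k}^{1/2}\|\phi_{i,j,k}\|_\infty$, for every $m\in\mathbb N$ and every $i$, $\sum_{k=1}^{m}\sum_{j=1}^{N(k)}\beta_{i,j,k}^2\le b_1m^{b_2}$. (5) There is an absolutely summable sequence $\{\alpha_k\}$ such that for all $k\in\mathbb N$, $t\ge p+1$ and $i$, $\lambda_{i,k}\sum_{j=1}^{N(k)}\mathbb E\big[(\phi_{i,j,k}(Y_{t-1}))^2\big]\le\alpha_k$; and there are $\beta_1,\beta_2\in(0,\infty)$ and an increasing sequence $\{M(T)\}_{T\in\mathbb N}$ with $\sum_{k=M(T)}^\infty\alpha_k\le\beta_1T^{-\beta_2}$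 for every $T\in\mathbb N$. (6) For each $t$ and $i$, $\varepsilon_{i,t}$ is sub-Gaussian with variance proxy $\sigma_i^2\in(0,\infty)$ and admits a density $\psi$ such that $\inf_{x\in A}\psi(x)>0$ for every compact $A\subseteq\mathrm{supp}(\varepsilon_{i,t})$. Set $\sigma^2=\max_i\sigma_i^2$. Define $$c_{1,T}(\delta,\gamma,L)=\frac{T}{\gamma^2}\Big(\delta\,(d\,b_1L^{b_2})^{-1/2}-\frac{\sigma}{\sqrt T}\Big)^2,\qquad c_{2,T}(\gamma)=\frac{\big(\gamma-\sqrt{2\sigma^2\log(dT)}\big)^2}{2\sigma^2}.$$ Then for any $\delta,\gamma\in(0,\infty)$ there is a $c\in(0,\infty)$ such that for all $T$, with $L=M(T)$, $$\mathbb P\Big(\tfrac1{T^2}\,\eta'\mathcal K(X,X)\eta>\delta^2\Big)\le d\exp\big(-c\,c_{1,T}(\delta,\gamma,L)\big)+d\exp\big(-c_{2,T}(\gamma)\big)+\frac{2d^2\sigma^2}{\delta^2T}\,\beta_1T^{-\beta_2}.$$ Moreover, there are constants $c_1,c_2\in(0,\infty)$ and $c_0\in(0,\infty)$, not depending on $T$, such that if (with $L=M(T)$) $$\delta\ge c_0\sqrt{\frac{\log T}{T}}\,L^{b_2/2}\gamma\qquad\text{and}\qquad\gamma\ge\sqrt{4\sigma^2\log(dT)},$$ then, with probability at least $1-c_1T^{-c_2}$, $\tfrac1{T^2}\,\eta'\mathcal K(X,X)\eta\le\delta^2$.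
   Context: **Model.** $d,p\in\mathbb N$ and $\mathcal X\subseteq\mathbb R^d$. $\{X_t\}_{t\in\mathbb Z}$ is a causal, stationary $\mathcal X$-valued process with $X_t=g(X_{t-1},\dots,X_{t-p})+\varepsilon_t$, where $g:\mathcal X^p\to\mathbb R^d$ and $\varepsilon_t=(\varepsilon_{1,t},\dots,\varepsilon_{d,t})'$ are i.i.d. in $t$, mean zero, with $\varepsilon_t$ independent of $(X_s)_{s<t}$. Put $Y_t=(X_t',\dots,X_{t-p+1}')'\in\mathcal X^p$. A real random variable $Z$ is sub-Gaussian with variance proxy $s^2$ if $\mathbb E e^{uZ}\le e^{s^2u^2/2}$ for all $u\in\mathbb R$. $\|f\|_\infty=\sup_x\max_i|f_i(x)|$. **Kernel matrix.** $K_1,\dots,K_d:\mathcal X^p\times\mathcal X^p\to\mathbb R$ are symmetric positive definite kernels. For the sample $X=(X_1,\dots,X_T)$, $T>p$: $K_i(X,X)=[K_i(Y_{s-1},Y_{t-1})]_{s,t=p+1,\dots,T}$, $\mathcal K(X,X)=\mathrm{diag}(K_1(X,X),\dots,K_d(X,X))\in\mathbb R^{d(T-p)\times d(T-p)}$, and $\eta=(\varepsilon_{1,p+1},\dots,\varepsilon_{1,T},\dots,\varepsilon_{d,p+1},\dots,\varepsilon_{d,T})'$. Thus $\eta'\mathcal K(X,X)\eta=\sum_{i=1}^d\sum_{s,t=p+1}^T\varepsilon_{i,s}K_i(Y_{s-1},Y_{t-1})\varepsilon_{i,t}$. *)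

theory Defs
  imports "HOL-Probability.Probability"
begin

text \<open>The dimension of the process is \<open>CARD('d)\<close>, time is \<open>int\<close>. A point
  \<open>(y\<^sub>0, \<dots>, y\<^bsub>p-1\<^esub>)\<close> of \<open>S\<^sup>p\<close> is an extensional function on \<open>{..<p}\<close>.\<close>

abbreviation (input) pow_set :: "nat \<Rightarrow> 'a set \<Rightarrow> (nat \<Rightarrow> 'a) set" where
  "pow_set p S \<equiv> PiE {..<p} (\<lambda>_. S)"

definition pow_borel :: "nat \<Rightarrow> 'a::topological_space set \<Rightarrow> (nat \<Rightarrow> 'a) measure" where
  "pow_borel p S = restrict_space (PiM {..<p} (\<lambda>_. borel)) (pow_set p S)"

text \<open>\<open>lagvec p X t\<close> is \<open>Y\<^sub>t = (X\<^sub>t, X\<^bsub>t-1\<^esub>, \<dots>, X\<^bsub>t-p+1\<^esub>)\<close>.\<close>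

definition lagvec :: "nat \<Rightarrow> (int \<Rightarrow> 'w \<Rightarrow> 'a) \<Rightarrow> int \<Rightarrow> 'w \<Rightarrow> nat \<Rightarrow> 'a" where
  "lagvec p X t \<omega> = (\<lambda>j\<in>{..<p}. X (t - int j) \<omega>)"

text \<open>\<open>infnorm\<close> is the maximum norm. The supremum is taken in \<open>ennreal\<close>, so that it is
  \<open>\<top>\<close> for unbounded functions.\<close>

definition sup_norm :: "'a set \<Rightarrow> ('a \<Rightarrow> 'b::euclidean_space) \<Rightarrow> ennreal" where
  "sup_norm S f = (SUP x\<in>S. ennreal (infnorm (f x)))"

definition stationary_process ::
    "'w measure \<Rightarrow> (int \<Rightarrow> 'w \<Rightarrow> 'a::topological_space) \<Rightarrow> bool" where
  "stationary_process M X \<longleftrightarrow>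
     (\<forall>h. distr M (PiM UNIV (\<lambda>_. borel)) (\<lambda>\<omega> t. X (t + h) \<omega>) =
          distr M (PiM UNIV (\<lambda>_. borel)) (\<lambda>\<omega> t. X t \<omega>))"

text \<open>\<open>X\<^sub>t\<close> is a function of present and past innovations.\<close>

definition causal_process :: "'w measure \<Rightarrow> (int \<Rightarrow> 'w \<Rightarrow> 'a::topological_space) \<Rightarrow>
    (int \<Rightarrow> 'w \<Rightarrow> 'b::topological_space) \<Rightarrow> bool" where
  "causal_process M X \<epsilon> \<longleftrightarrow>
     (\<exists>h \<in> PiM UNIV (\<lambda>_::nat. borel) \<rightarrow>\<^sub>M borel.
        \<forall>t. AE \<omega> in M. X t \<omega> = h (\<lambda>k. \<epsilon> (t - int k) \<omega>))"

locale nonlinear_var = prob_space M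
  for M :: "'w measure" +
  fixes S :: "(real ^ 'd) set"
    and p :: nat
    and g :: "(nat \<Rightarrow> real ^ 'd) \<Rightarrow> real ^ 'd"
    and X \<epsilon> :: "int \<Rightarrow> 'w \<Rightarrow> real ^ 'd"
  assumes p_pos: "1 \<le> p"
    and X_measurable: "\<And>t. X t \<in> borel_measurable M"
    and X_in: "\<And>t \<omega>. \<omega> \<in> space M \<Longrightarrow> X t \<omega> \<in> S"
    and stationary: "stationary_process M X"
    and causal: "causal_process M X \<epsilon>"
    and model_eq: "\<And>t. AE \<omega> in M. X t \<omega> = g (lagvec p X (t - 1) \<omega>) + \<epsilon> t \<omega>"
    and noise_indep: "indep_vars (\<lambda>_. borel) \<epsilon> UNIV"
    and noise_ident: "\<And>s t. distr M borel (\<epsilon> s) = distr M borel (\<epsilon> t)"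
    and noise_integrable: "\<And>t. integrable M (\<epsilon> t)"
    and noise_mean: "\<And>t. expectation (\<epsilon> t) = 0"
    and noise_indep_past: "\<And>t. indep_set
          (sets (vimage_algebra (space M) (\<epsilon> t) borel))
          (sets (vimage_algebra (space M) (\<lambda>\<omega>. \<lambda>s\<in>{..<t}. X s \<omega>) (PiM {..<t} (\<lambda>_. borel))))"

text \<open>As usual for reproducing kernels, \<open>positive definite\<close> only asks for
  non-negative quadratic forms.\<close>

definition spd_kernel :: "'a set \<Rightarrow> ('a \<Rightarrow> 'a \<Rightarrow> real) \<Rightarrow> bool" where
  "spd_kernel A k \<longleftrightarrow>
     (\<forall>x\<in>A. \<forall>y\<in>A. k x y = k y x) \<and>
     (\<forall>n::nat. \<forall>x c. (\<forall>a<n. x a \<in> A) \<longrightarrow>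
        0 \<le> (\<Sum>a<n. \<Sum>b<n. c a * c b * k (x a) (x b)))"

definition subgaussian :: "'w measure \<Rightarrow> real \<Rightarrow> ('w \<Rightarrow> real) \<Rightarrow> bool" where
  "subgaussian M v Z \<longleftrightarrow>
     (\<forall>u. integrable M (\<lambda>\<omega>. exp (u * Z \<omega>)) \<and>
          (\<integral>\<omega>. exp (u * Z \<omega>) \<partial>M) \<le> exp (v * u\<^sup>2 / 2))"

definition distr_support :: "'w measure \<Rightarrow> ('w \<Rightarrow> 'a::topological_space) \<Rightarrow> 'a set" where
  "distr_support M Z =
     {x. \<forall>U. open U \<and> x \<in> U \<longrightarrow> measure M {\<omega> \<in> space M. Z \<omega> \<in> U} > 0}"

text \<open>The infimum is taken in \<open>ennreal\<close>, where the empty set has infimum \<open>\<top>\<close>.\<close>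

definition has_density_bounded_below :: "'w measure \<Rightarrow> ('w \<Rightarrow> real) \<Rightarrow> bool" where
  "has_density_bounded_below M Z \<longleftrightarrow>
     (\<exists>\<psi> :: real \<Rightarrow> real. (\<forall>x. 0 \<le> \<psi> x) \<and>
        distributed M lborel Z (\<lambda>x. ennreal (\<psi> x)) \<and>
        (\<forall>A. compact A \<and> A \<subseteq> distr_support M Z \<longrightarrow> 0 < (INF x\<in>A. ennreal (\<psi> x))))"

text \<open>The block-diagonal matrix \<open>diag(K\<^sub>1(X,X), \<dots>, K\<^sub>d(X,X))\<close> and the vector \<open>\<eta>\<close> are
  indexed by pairs (component, time) from \<open>UNIV \<times> {p+1..T}\<close>.\<close>

definition kernel_matrix ::
    "nat \<Rightarrow> ('d \<Rightarrow> (nat \<Rightarrow> 'a) \<Rightarrow> (nat \<Rightarrow> 'a) \<Rightarrow> real) \<Rightarrow> (int \<Rightarrow> 'w \<Rightarrow> 'a) \<Rightarrow> 'w \<Rightarrow>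
     'd \<times> int \<Rightarrow> 'd \<times> int \<Rightarrow> real" where
  "kernel_matrix p K X \<omega> = (\<lambda>(i, s) (j, t).
     if i = j then K i (lagvec p X (s - 1) \<omega>) (lagvec p X (t - 1) \<omega>) else 0)"

definition noise_vector :: "(int \<Rightarrow> 'w \<Rightarrow> real ^ 'd) \<Rightarrow> 'w \<Rightarrow> 'd \<times> int \<Rightarrow> real" where
  "noise_vector \<epsilon> \<omega> = (\<lambda>(i, t). \<epsilon> t \<omega> $ i)"

definition quad_form :: "'i set \<Rightarrow> ('i \<Rightarrow> 'i \<Rightarrow> real) \<Rightarrow> ('i \<Rightarrow> real) \<Rightarrow> real" where
  "quad_form I A v = (\<Sum>a\<in>I. \<Sum>b\<in>I. v a * A a b * v b)"

definition noise_quad :: "nat \<Rightarrow> ('d \<Rightarrow> (nat \<Rightarrow> real ^ 'd) \<Rightarrow> (nat \<Rightarrow> real ^ 'd) \<Rightarrow> real) \<Rightarrow>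
    (int \<Rightarrow> 'w \<Rightarrow> real ^ 'd) \<Rightarrow> (int \<Rightarrow> 'w \<Rightarrow> real ^ 'd) \<Rightarrow> nat \<Rightarrow> 'w \<Rightarrow> real" where
  "noise_quad p K X \<epsilon> T \<omega> =
     quad_form (UNIV \<times> {int p + 1..int T}) (kernel_matrix p K X \<omega>) (noise_vector \<epsilon> \<omega>)"

lemma noise_quad_eq:
  "noise_quad p K X \<epsilon> T \<omega> =
     (\<Sum>i\<in>UNIV. \<Sum>s\<in>{int p + 1..int T}. \<Sum>t\<in>{int p + 1..int T}.
        \<epsilon> s \<omega> $ i * K i (lagvec p X (s - 1) \<omega>) (lagvec p X (t - 1) \<omega>) * \<epsilon> t \<omega> $ i)"
proof -
  have "(\<Sum>j\<in>UNIV. \<Sum>t\<in>A. \<epsilon> s \<omega> $ i * (if i = j then f t else 0) * \<epsilon> t \<omega> $ j) =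
        (\<Sum>t\<in>A. \<epsilon> s \<omega> $ i * f t * \<epsilon> t \<omega> $ i)" for i s f and A :: "int set"
    by (subst sum.swap) (simp add: if_distrib if_distribR sum.delta cong: if_cong)
  then show ?thesis
    by (simp add: noise_quad_def quad_form_def kernel_matrix_def noise_vector_def
        sum.cartesian_product')
qed

text \<open>\<open>N(k)\<close>, with \<open>q\<close> in place of \<open>dp\<close>.\<close>

definition mult_num :: "nat \<Rightarrow> nat \<Rightarrow> nat" where
  "mult_num q k = (k + q - 1) choose (q - 1)"

definition c1_rate :: "nat \<Rightarrow> real \<Rightarrow> real \<Rightarrow> real \<Rightarrow> nat \<Rightarrow> real \<Rightarrow> real \<Rightarrow> nat \<Rightarrow> real" where
  "c1_rate d b1 b2 \<sigma> T \<delta> \<gamma> L =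
     real T / \<gamma>\<^sup>2 *
       (\<delta> * (real d * b1 * real L powr b2) powr (- 1 / 2) - \<sigma> / sqrt (real T))\<^sup>2"

definition c2_rate :: "nat \<Rightarrow> real \<Rightarrow> nat \<Rightarrow> real \<Rightarrow> real" where
  "c2_rate d \<sigma> T \<gamma> = (\<gamma> - sqrt (2 * \<sigma>\<^sup>2 * ln (real (d * T))))\<^sup>2 / (2 * \<sigma>\<^sup>2)"

end

theory Submission
  imports Defs
begin

text \<open>The quadratic form is a sum over \<open>i\<close> of squared RKHS norms \<open>\<parallel>S\<^sub>i\<parallel>\<^sup>2\<close> of the martingales
  \<open>S\<^sub>i = \<Sum>\<^sub>t \<epsilon>\<^bsub>i,t\<^esub> K\<^sub>i(Y\<^bsub>t-1\<^esub>, \<cdot>)\<close>, whose increments have norm at most \<open>\<kappa> \<bar>\<epsilon>\<^bsub>i,t\<^esub>\<bar>\<close>. Following Pinelis,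
  \<open>cosh (l \<parallel>S\<^sub>i\<parallel>)\<close> grows in mean by a factor of at most \<open>exp (\<sigma>\<^sup>2 l\<^sup>2 \<kappa>\<^sup>2)\<close> per step, which yields
  \<open>P (T\<^sup>-\<^sup>2 \<eta>' K \<eta> > \<delta>\<^sup>2) \<le> 2 d exp (- T \<delta>\<^sup>2 / (4 d \<sigma>\<^sup>2 \<kappa>\<^sup>2))\<close> without truncating the kernel expansion.
  Both claims follow, since \<open>c\<^bsub>1,T\<^esub> = O(T)\<close> if \<open>b\<^sub>2 \<ge> 0\<close>, while \<open>b\<^sub>2 < 0\<close> forces the kernels to vanish.\<close>

section \<open>Hyperbolic functions and Pinelis' inequality\<close>

text \<open>Reindexing along doubling drops the vanishing odd terms. Every remaining term is a power
  of \<open>x\<^sup>2\<close>, so the series can be compared termwise in the squared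
  argument.\<close>

lemma cosh_even_sums: "(\<lambda>n. x ^ (2 * n) / fact (2 * n)) sums cosh (x :: real)"
proof -
  have "strict_mono ((*) (2::nat))"
    by (simp add: strict_mono_def)
  moreover have "n \<notin> range ((*) 2) \<Longrightarrow> (if even n then x ^ n /\<^sub>R fact n else 0) = 0" for n :: nat
    by (auto elim!: evenE)
  ultimately have "(\<lambda>n. if even (2 * n) then x ^ (2 * n) /\<^sub>R fact (2 * n) else 0) sums cosh x"
    using cosh_converges[of x] by (subst sums_mono_reindex) auto
  then show ?thesis
    by (simp add: divide_inverse_commute)
qed

text \<open>As a function of \<open>z\<close>, \<open>cosh (sqrt z)\<close> is a power series with
  nonnegative coefficients, hence increasing and convex for \<open>z \<ge> 0\<close>. Both
  properties are checked on each power separately.\<close>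

lemma cosh_sqrt_convex:
  fixes a b u w z :: real
  assumes "0 \<le> a" "0 \<le> b" "a + b = 1" "0 \<le> z" "z \<le> a * u\<^sup>2 + b * w\<^sup>2"
  shows "cosh (sqrt z) \<le> a * cosh u + b * cosh w"
proof -
  have "(\<lambda>n. a * (u ^ (2 * n) / fact (2 * n)) + b * (w ^ (2 * n) / fact (2 * n))) sums
      (a * cosh u + b * cosh w)"
    by (intro sums_add sums_mult cosh_even_sums)
  moreover have "sqrt z ^ (2 * n) / fact (2 * n) \<le>
      a * (u ^ (2 * n) / fact (2 * n)) + b * (w ^ (2 * n) / fact (2 * n))" for n
  proof -
    have cvx: "convex_on {0..} (\<lambda>x::real. x ^ n)"
      by (cases "even n") (auto intro: convex_power_odd convex_on_subset[OF convex_power_even])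
    have "sqrt z ^ (2 * n) = z ^ n"
      using assms by (simp add: power_mult)
    also have "\<dots> \<le> (a * u\<^sup>2 + b * w\<^sup>2) ^ n"
      using assms by (intro power_mono)
    also have "\<dots> \<le> a * (u\<^sup>2) ^ n + b * (w\<^sup>2) ^ n"
      using convex_onD[OF cvx, of b "u\<^sup>2" "w\<^sup>2"] assms by (simp add: eq_diff_eq[symmetric])
    finally show ?thesis
      by (simp add: power_mult[symmetric] add_divide_distrib[symmetric] divide_right_mono)
  qed
  ultimately show ?thesis
    by (intro sums_le[OF _ cosh_even_sums])
qed

text \<open>With \<open>q = \<parallel>x\<parallel>\<^sup>2\<close>, \<open>b = \<langle>x, h\<rangle>\<close>, \<open>k = \<parallel>h\<parallel>\<^sup>2\<close> this is Pinelis' estimate for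
  \<open>cosh (l \<parallel>x + e h\<parallel>)\<close> in a Hilbert space. The point \<open>x + e h\<close> has squared norm at most the convex
  combination, with weights \<open>(1 \<plusminus> \<theta>) / 2\<close>, of \<open>(\<parallel>x\<parallel> \<plusminus> e \<kappa>)\<^sup>2\<close>.\<close>

lemma cosh_norm_perturb:
  fixes q b k e \<kappa> l :: real
  defines "\<theta> \<equiv> b / (sqrt q * \<kappa>)"
  assumes q: "0 \<le> q" and b: "b\<^sup>2 \<le> q * k" and k: "k \<le> \<kappa>\<^sup>2" and \<kappa>: "0 < \<kappa>" and l: "0 \<le> l"
    and nonneg: "0 \<le> q + 2 * e * b + e\<^sup>2 * k"
  shows "\<bar>\<theta>\<bar> \<le> 1"
    and "cosh (l * sqrt (q + 2 * e * b + e\<^sup>2 * k)) \<le>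
      cosh (l * sqrt q) * cosh (l * \<kappa> * e) + \<theta> * sinh (l * sqrt q) * sinh (l * \<kappa> * e)"
proof -
  have "b\<^sup>2 \<le> q * \<kappa>\<^sup>2"
    using b k q by (meson mult_left_mono order_trans)
  then have "\<bar>b\<bar> \<le> sqrt (q * \<kappa>\<^sup>2)"
    by (simp add: real_le_rsqrt)
  then have abs_b: "\<bar>b\<bar> \<le> sqrt q * \<kappa>"
    using \<kappa> by (simp add: real_sqrt_mult)
  then show \<theta>: "\<bar>\<theta>\<bar> \<le> 1"
    using \<kappa> q by (cases "q = 0") (auto simp: \<theta>_def abs_mult divide_le_eq)
  \<comment> \<open>If \<open>q = 0\<close>, division by zero makes \<open>\<theta>\<close> zero,
    and \<open>abs_b\<close> forces \<open>b = 0\<close>, so the identity survives.\<close>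
  have b_eq: "\<theta> * (sqrt q * \<kappa>) = b"
    using abs_b \<kappa> q by (cases "q = 0") (auto simp: \<theta>_def)
  define u w where "u = l * sqrt q + l * \<kappa> * e" and "w = l * sqrt q - l * \<kappa> * e"
  \<comment> \<open>The weights reproduce the cross term \<open>2 * e * b\<close> exactly; the only
    loss is replacing \<open>k\<close> by \<open>\<kappa>\<^sup>2\<close>.\<close>
  have "(1 + \<theta>) / 2 * u\<^sup>2 + (1 - \<theta>) / 2 * w\<^sup>2 =
      l\<^sup>2 * ((sqrt q)\<^sup>2 + 2 * e * (\<theta> * (sqrt q * \<kappa>)) + e\<^sup>2 * \<kappa>\<^sup>2)"
    unfolding u_def w_def by (simp add: field_simps power2_eq_square)
  also have "\<dots> \<ge> l\<^sup>2 * (q + 2 * e * b + e\<^sup>2 * k)"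
    unfolding b_eq using q k by (intro mult_left_mono add_mono order_refl) auto
  finally have "cosh (sqrt (l\<^sup>2 * (q + 2 * e * b + e\<^sup>2 * k))) \<le>
      (1 + \<theta>) / 2 * cosh u + (1 - \<theta>) / 2 * cosh w"
  proof (intro cosh_sqrt_convex)
    show "(1 + \<theta>) / 2 + (1 - \<theta>) / 2 = 1"
      by (simp add: field_simps)
  qed (use \<theta> nonneg in auto)
  \<comment> \<open>The addition formulas separate the factors in \<open>q\<close> (the past) from
    those in \<open>e\<close> (the new noise).\<close>
  also have "\<dots> = cosh (l * sqrt q) * cosh (l * \<kappa> * e) + \<theta> * sinh (l * sqrt q) * sinh (l * \<kappa> * e)"
    unfolding u_def w_def by (simp add: cosh_add cosh_diff field_simps)
  finally show "cosh (l * sqrt (q + 2 * e * b + e\<^sup>2 * k)) \<le>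
      cosh (l * sqrt q) * cosh (l * \<kappa> * e) + \<theta> * sinh (l * sqrt q) * sinh (l * \<kappa> * e)"
    using l by (simp add: real_sqrt_mult)
qed

text \<open>For \<open>x \<ge> 0\<close> this combines \<open>x \<le> sinh x\<close> with
  \<open>cosh x - sinh x = exp (- x) \<ge> 1 - x\<close>; oddness of \<open>sinh\<close> and
  evenness of \<open>cosh\<close> give the rest.\<close>

lemma abs_sinh_minus_self_le: "\<bar>sinh x - x\<bar> \<le> cosh x - (1 :: real)"
proof -
  have *: "\<bar>sinh y - y\<bar> \<le> cosh y - 1" if "0 \<le> y" for y :: real
  proof -
    have "cosh y - sinh y = exp (- y)"
      by (simp add: cosh_minus_sinh)
    moreover have "1 + (- y) \<le> exp (- y)"
      by (rule exp_ge_add_one_self)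
    moreover have "y \<le> sinh y"
      using real_le_abs_sinh[of y] that by (simp add: sinh_def exp_minus[symmetric])
    ultimately show ?thesis
      by simp
  qed
  show ?thesis
    using *[of x] *[of "- x"] by (cases "0 \<le> x") auto
qed

text \<open>For a symmetric law the mean of \<open>sinh\<close> would vanish. In general it is at
  most the mean of \<open>cosh\<close> minus 1, and absorbing it doubles the exponent from
  \<open>v * u\<^sup>2 / 2\<close> to \<open>v * u\<^sup>2\<close>.\<close>

lemma (in prob_space) subgaussian_cosh_sinh:
  assumes Z: "subgaussian M v Z" "integrable M Z" "expectation Z = 0"
  shows "integrable M (\<lambda>\<omega>. cosh (u * Z \<omega>))" "integrable M (\<lambda>\<omega>. sinh (u * Z \<omega>))"
    and "expectation (\<lambda>\<omega>. cosh (u * Z \<omega>)) + \<bar>expectation (\<lambda>\<omega>. sinh (u * Z \<omega>))\<bar> \<le> exp (v * u\<^sup>2)"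
proof -
  have int: "integrable M (\<lambda>\<omega>. exp (r * Z \<omega>))"
    and le: "expectation (\<lambda>\<omega>. exp (r * Z \<omega>)) \<le> exp (v * r\<^sup>2 / 2)" for r
    using Z(1) by (auto simp: subgaussian_def)
  have intm: "integrable M (\<lambda>\<omega>. exp (- (u * Z \<omega>)))"
    using int[of "- u"] by simp
  show c: "integrable M (\<lambda>\<omega>. cosh (u * Z \<omega>))"
    unfolding cosh_def using int[of u] intm by auto
  show s: "integrable M (\<lambda>\<omega>. sinh (u * Z \<omega>))"
    unfolding sinh_def using int[of u] intm by auto
  have "expectation (\<lambda>\<omega>. cosh (u * Z \<omega>)) =
      (expectation (\<lambda>\<omega>. exp (u * Z \<omega>)) + expectation (\<lambda>\<omega>. exp (- u * Z \<omega>))) / 2"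
    unfolding cosh_def using int[of u] intm by simp
  then have C: "expectation (\<lambda>\<omega>. cosh (u * Z \<omega>)) \<le> exp (v * u\<^sup>2 / 2)"
    using le[of u] le[of "- u"] by simp
  \<comment> \<open>Subtracting the centred variable \<open>u * Z\<close> changes nothing in the
    mean but makes the integrand comparable to \<open>cosh - 1\<close>.\<close>
  have "expectation (\<lambda>\<omega>. sinh (u * Z \<omega>)) = expectation (\<lambda>\<omega>. sinh (u * Z \<omega>) - u * Z \<omega>)"
    using s Z by simp
  also have "\<bar>\<dots>\<bar> \<le> expectation (\<lambda>\<omega>. \<bar>sinh (u * Z \<omega>) - u * Z \<omega>\<bar>)"
    by (rule integral_abs_bound)
  also have "\<dots> \<le> expectation (\<lambda>\<omega>. cosh (u * Z \<omega>) - 1)"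
    using s c Z by (intro integral_mono abs_sinh_minus_self_le integrable_abs) auto
  also have "\<dots> = expectation (\<lambda>\<omega>. cosh (u * Z \<omega>)) - 1"
    using c by (simp add: prob_space)
  finally have "expectation (\<lambda>\<omega>. cosh (u * Z \<omega>)) + \<bar>expectation (\<lambda>\<omega>. sinh (u * Z \<omega>))\<bar>
      \<le> 2 * exp (v * u\<^sup>2 / 2) - 1"
    using C by simp
  \<comment> \<open>This is \<open>2 * s - 1 \<le> s\<^sup>2\<close>, that is
    \<open>(s - 1)\<^sup>2 \<ge> 0\<close>.\<close>
  also have "\<dots> \<le> (exp (v * u\<^sup>2 / 2))\<^sup>2"
    using sum_squares_ge_zero[of "exp (v * u\<^sup>2 / 2) - 1" 0]
    by (simp add: power2_eq_square algebra_simps)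
  also have "\<dots> = exp (v * u\<^sup>2)"
    by (simp add: exp_double[symmetric])
  finally show "expectation (\<lambda>\<omega>. cosh (u * Z \<omega>)) + \<bar>expectation (\<lambda>\<omega>. sinh (u * Z \<omega>))\<bar>
      \<le> exp (v * u\<^sup>2)" .
qed

text \<open>\<open>Q n\<close> plays the squared RKHS norm of the first \<open>n\<close> weighted
  kernel sections and \<open>B\<close> the inner product of the first \<open>m\<close> with the next
  section. Working with quadratic forms avoids constructing the Hilbert space.\<close>

lemma spd_kernel_cauchy_schwarz:
  fixes c :: "nat \<Rightarrow> real"
  assumes spd: "spd_kernel A k" and x: "\<And>a. a \<le> m \<Longrightarrow> x a \<in> A"
  defines "Q \<equiv> \<lambda>n. \<Sum>a<n. \<Sum>b<n. c a * c b * k (x a) (x b)"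
    and "B \<equiv> \<Sum>a<m. c a * k (x a) (x m)"
  shows "0 \<le> Q m" and "Q (Suc m) = Q m + 2 * c m * B + (c m)\<^sup>2 * k (x m) (x m)"
    and "0 \<le> Q (Suc m)" and "B\<^sup>2 \<le> Q m * k (x m) (x m)"
proof -
  have sym: "k (x a) (x b) = k (x b) (x a)" if "a \<le> m" "b \<le> m" for a b
    using spd x that by (auto simp: spd_kernel_def)
  have all: "0 \<le> (\<Sum>a<n. \<Sum>b<n. d a * d b * k (y a) (y b))" if "\<And>a. a < n \<Longrightarrow> y a \<in> A"
    for n :: nat and y and d :: "nat \<Rightarrow> real"
    using spd that unfolding spd_kernel_def by blast
  have pos: "0 \<le> (\<Sum>a<n. \<Sum>b<n. d a * d b * k (x a) (x b))" if "n \<le> Suc m" for n d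
    using that x by (intro all) simp
  have expand: "(\<Sum>a<Suc m. \<Sum>b<Suc m. c' a * c' b * k (x a) (x b)) =
      (\<Sum>a<m. \<Sum>b<m. c' a * c' b * k (x a) (x b)) +
      2 * c' m * (\<Sum>a<m. c' a * k (x a) (x m)) + (c' m)\<^sup>2 * k (x m) (x m)" for c'
  proof -
    have "(\<Sum>b<m. c' m * c' b * k (x m) (x b)) = (\<Sum>b<m. c' b * c' m * k (x b) (x m))"
      by (rule sum.cong) (auto simp: sym)
    then show ?thesis
      by (simp add: sum.distrib sum_distrib_left power2_eq_square algebra_simps)
  qed
  show Q: "0 \<le> Q m" "0 \<le> Q (Suc m)"
    unfolding Q_def by (rule pos; simp)+
  show "Q (Suc m) = Q m + 2 * c m * B + (c m)\<^sup>2 * k (x m) (x m)"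
    unfolding Q_def B_def by (rule expand)
  \<comment> \<open>Replacing the last coefficient by an arbitrary \<open>r\<close> leaves
    \<open>Q m\<close> and \<open>B\<close> unchanged, so this quadratic polynomial in
    \<open>r\<close> is nonnegative everywhere.\<close>
  have quad: "0 \<le> Q m + 2 * r * B + r\<^sup>2 * k (x m) (x m)" for r
    using pos[of "Suc m" "c(m := r)"] unfolding expand Q_def B_def by simp
  have k: "0 \<le> k (x m) (x m)"
    using all[of 1 "\<lambda>_. x m" "\<lambda>_. 1"] x[of m] by simp
  show "B\<^sup>2 \<le> Q m * k (x m) (x m)"
  proof (cases "k (x m) (x m) = 0")
    case True
    have "B = 0"
    proof (rule ccontr)
      assume "B \<noteq> 0"
      \<comment> \<open>With zero leading coefficient the polynomial is affine in \<open>r\<close>;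
        the chosen \<open>r\<close> gives it the value -1.\<close>
      then show False
        using quad[of "- (Q m + 1) / (2 * B)"] True Q by (simp add: field_simps)
    qed
    then show ?thesis
      using True by simp
  next
    case False
    \<comment> \<open>The point \<open>- B / k (x m) (x m)\<close> is the minimiser of the
      polynomial.\<close>
    then have "Q m + 2 * (- B / k (x m) (x m)) * B + (- B / k (x m) (x m))\<^sup>2 * k (x m) (x m) =
        Q m - B\<^sup>2 / k (x m) (x m)"
      by (simp add: field_simps power2_eq_square)
    then have "0 \<le> Q m - B\<^sup>2 / k (x m) (x m)"
      using quad[of "- B / k (x m) (x m)"] by simp
    with False k show ?thesis
      by (simp add: field_simps)
  qed
qed

section \<open>Independence of the noise from the past\<close>

context nonlinear_var
begin

text \<open>States and noise are both recorded, because the partial quadratic forms depend on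
  both.\<close>

definition past :: "int \<Rightarrow> 'w measure" where
  "past t = vimage_algebra (space M) (\<lambda>\<omega>. \<lambda>s\<in>{..<t}. (X s \<omega>, \<epsilon> s \<omega>))
    (PiM {..<t} (\<lambda>_. borel \<Otimes>\<^sub>M borel))"

lemma noise_measurable: "\<epsilon> t \<in> borel_measurable M"
  using noise_integrable by (rule borel_measurable_integrable)

lemma past_pair_measurable:
  assumes "s < t"
  shows "(\<lambda>\<omega>. (X s \<omega>, \<epsilon> s \<omega>)) \<in> past t \<rightarrow>\<^sub>M borel \<Otimes>\<^sub>M borel"
proof -
  have "(\<lambda>\<omega>. \<lambda>s\<in>{..<t}. (X s \<omega>, \<epsilon> s \<omega>)) \<in> past t \<rightarrow>\<^sub>M PiM {..<t} (\<lambda>_. borel \<Otimes>\<^sub>M borel)"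
    unfolding past_def by (rule measurable_vimage_algebra1) (auto simp: space_PiM space_pair_measure)
  from measurable_compose[OF this measurable_component_singleton, of s] show ?thesis
    using assms by simp
qed

lemma past_measurable_X: "s < t \<Longrightarrow> X s \<in> borel_measurable (past t)"
  using measurable_compose[OF past_pair_measurable measurable_fst] by simp

lemma past_measurable_noise: "s < t \<Longrightarrow> \<epsilon> s \<in> borel_measurable (past t)"
  using measurable_compose[OF past_pair_measurable measurable_snd] by simp

lemma space_past: "space (past t) = space M"
  by (simp add: past_def)

lemma path_measurable:
  "(\<lambda>\<omega>. \<lambda>s\<in>{..<t}. (X s \<omega>, \<epsilon> s \<omega>)) \<in> M \<rightarrow>\<^sub>M PiM {..<t} (\<lambda>_. borel \<Otimes>\<^sub>M borel)"
  using X_measurable noise_measurable by (intro measurable_restrict measurable_Pair)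

lemma subalgebra_past: "subalgebra M (past t)"
  unfolding subalgebra_def space_past
  using sets_image_in_sets[OF refl path_measurable] by (simp add: past_def)

text \<open>The noise is independent of the past of the pair \<open>(X, \<epsilon>)\<close>. This rests on causality: since
  \<open>g\<close> need not be measurable, the model equation does not make \<open>\<epsilon>\<close> a measurable function of \<open>X\<close>.\<close>

lemma prob_past_noise:
  assumes A: "A \<in> sets (past t)" and D: "D \<in> sets borel"
  shows "prob (A \<inter> (\<epsilon> t -` D \<inter> space M)) = prob A * prob (\<epsilon> t -` D \<inter> space M)"
proof -
  let ?P = "PiM {..<t} (\<lambda>_. borel :: (real^'d) measure)"
  let ?PP = "PiM {..<t} (\<lambda>_. borel \<Otimes>\<^sub>M borel :: ((real^'d) \<times> (real^'d)) measure)"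
  obtain h where h: "h \<in> PiM UNIV (\<lambda>_::nat. borel) \<rightarrow>\<^sub>M borel"
    and Xh: "\<And>t. AE \<omega> in M. X t \<omega> = h (\<lambda>k. \<epsilon> (t - int k) \<omega>)"
    using causal unfolding causal_process_def by blast
  define \<Phi> where "\<Phi> = (\<lambda>\<omega>. \<lambda>s\<in>{..<t}. (X s \<omega>, \<epsilon> s \<omega>))"
  \<comment> \<open>\<open>\<Psi>\<close> rebuilds the path of pairs before \<open>t\<close> from
    the noise path before \<open>t\<close>, using the causal representation; the indices
    \<open>s - int k\<close> all stay below \<open>t\<close>.\<close>
  define \<Psi> where "\<Psi> = (\<lambda>f. \<lambda>s\<in>{..<t}. (h (\<lambda>k. f (s - int k)), f s))"
  define R where "R = (\<lambda>\<omega>. \<lambda>s\<in>{..<t}. \<epsilon> s \<omega>)"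
  have \<Psi>: "\<Psi> \<in> ?P \<rightarrow>\<^sub>M ?PP"
    unfolding \<Psi>_def
  proof (intro measurable_restrict measurable_Pair)
    fix s assume s: "s \<in> {..<t}"
    have "(\<lambda>f. \<lambda>k\<in>UNIV. f (s - int k)) \<in> ?P \<rightarrow>\<^sub>M PiM UNIV (\<lambda>_::nat. borel)"
      using s by (intro measurable_restrict measurable_component_singleton) auto
    from measurable_compose[OF this h]
    show "(\<lambda>f. h (\<lambda>k. f (s - int k))) \<in> ?P \<rightarrow>\<^sub>M borel"
      by (simp add: restrict_UNIV)
  qed (rule measurable_component_singleton)
  have R: "R \<in> M \<rightarrow>\<^sub>M ?P"
    unfolding R_def using noise_measurable by (intro measurable_restrict)
  have eq: "AE \<omega> in M. \<Phi> \<omega> = \<Psi> (R \<omega>)"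
  proof -
    \<comment> \<open>Time is countable, so one null set serves all \<open>s\<close>.\<close>
    have "AE \<omega> in M. \<forall>s. X s \<omega> = h (\<lambda>k. \<epsilon> (s - int k) \<omega>)"
      using Xh by (simp add: AE_all_countable)
    then show ?thesis
    proof eventually_elim
      case (elim \<omega>)
      have "(\<lambda>k. R \<omega> (s - int k)) = (\<lambda>k. \<epsilon> (s - int k) \<omega>)" if "s < t" for s
        using that by (auto simp: R_def)
      with elim show ?case
        by (auto simp: \<Phi>_def \<Psi>_def R_def fun_eq_iff)
    qed
  qed
  let ?P1 = "PiM {t} (\<lambda>_. borel :: (real^'d) measure)"
  let ?e = "\<lambda>\<omega>. \<lambda>s\<in>{t}. \<epsilon> s \<omega>"
  \<comment> \<open>The noise before \<open>t\<close> and the noise at \<open>t\<close> use disjoint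
    index sets of an independent family.\<close>
  have ind: "indep_var ?P R ?P1 ?e"
    unfolding R_def by (rule indep_var_restrict[OF noise_indep]) auto
  have D': "(\<lambda>f. f t) -` D \<inter> space ?P1 \<in> sets ?P1"
    using D by (intro measurable_sets[OF measurable_component_singleton]) auto
  have e_eq: "\<epsilon> t -` D \<inter> space M = ?e -` ((\<lambda>f. f t) -` D \<inter> space ?P1) \<inter> space M"
    by (auto simp: space_PiM)
  obtain B where B: "B \<in> sets ?PP" and A_eq: "A = \<Phi> -` B \<inter> space M"
  proof -
    have "\<Phi> \<in> space M \<rightarrow> space ?PP"
      by (auto simp: \<Phi>_def space_PiM space_pair_measure)
    then show ?thesis
      using A that unfolding past_def \<Phi>_def[symmetric] by (auto simp: sets_vimage_algebra2)
  qed
  \<comment> \<open>\<open>C\<close> is the version of \<open>A\<close> described by the noise path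
    alone; the two events agree up to a null set.\<close>
  define C where "C = R -` (\<Psi> -` B \<inter> space ?P) \<inter> space M"
  have BP: "\<Psi> -` B \<inter> space ?P \<in> sets ?P"
    using \<Psi> B by (rule measurable_sets)
  have C: "C \<in> events"
    unfolding C_def using R BP by (rule measurable_sets)
  have A': "A \<in> events"
    using A subalgebra_past by (auto simp: subalgebra_def)
  have E: "\<epsilon> t -` D \<inter> space M \<in> events"
    using noise_measurable D by (rule measurable_sets)
  have AC: "AE \<omega> in M. \<omega> \<in> A \<longleftrightarrow> \<omega> \<in> C"
    using eq AE_space
  proof eventually_elim
    case (elim \<omega>)
    then show ?case
      using measurable_space[OF R] by (auto simp: A_eq C_def)
  qed
  have "prob (A \<inter> (\<epsilon> t -` D \<inter> space M)) = prob (C \<inter> (\<epsilon> t -` D \<inter> space M))"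
    using AC A' C E by (intro finite_measure_eq_AE) auto
  also have "\<dots> = prob C * prob (\<epsilon> t -` D \<inter> space M)"
    unfolding C_def e_eq
  proof (rule indep_setD)
    show "indep_set (sigma_sets (space M) {R -` A \<inter> space M |A. A \<in> sets ?P})
        (sigma_sets (space M) {?e -` A \<inter> space M |A. A \<in> sets ?P1})"
      using ind by (simp add: indep_var_eq)
  qed (use BP D' in \<open>blast intro: sigma_sets.Basic\<close>)+
  also have "prob C = prob A"
    using AC A' C by (intro finite_measure_eq_AE) auto
  finally show ?thesis .
qed

text \<open>Independence passes to smaller sigma-algebras: \<open>U\<close> generates a part of
  \<open>past t\<close>, and \<open>f (\<epsilon> t)\<close> a part of what
  \<open>\<epsilon> t\<close> generates. This is the form that factorises expectations.\<close>

lemma indep_var_past_noise: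
  assumes U: "U \<in> borel_measurable (past t)" and f: "f \<in> borel_measurable borel"
  shows "indep_var borel (U :: _ \<Rightarrow> real) borel (\<lambda>\<omega>. f (\<epsilon> t \<omega>) :: real)"
proof -
  have "{U -` A \<inter> space M |A. A \<in> sets borel} \<subseteq> sets (past t)"
    using measurable_sets[OF U] by (auto simp: space_past)
  then have U': "sigma_sets (space M) {U -` A \<inter> space M |A. A \<in> sets borel} \<subseteq> sets (past t)"
    using sets.sigma_sets_subset[of _ "past t"] by (simp add: space_past)
  let ?E = "vimage_algebra (space M) (\<epsilon> t) borel"
  have fE: "(\<lambda>\<omega>. f (\<epsilon> t \<omega>)) \<in> borel_measurable ?E"
    by (rule measurable_compose[OF measurable_vimage_algebra1 f]) auto
  have "{(\<lambda>\<omega>. f (\<epsilon> t \<omega>)) -` A \<inter> space M |A. A \<in> sets borel} \<subseteq> sets ?E"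
    using measurable_sets[OF fE] by auto
  then have F': "sigma_sets (space M) {(\<lambda>\<omega>. f (\<epsilon> t \<omega>)) -` A \<inter> space M |A. A \<in> sets borel} \<subseteq> sets ?E"
    using sets.sigma_sets_subset[of _ ?E] by simp
  have "sets ?E \<subseteq> events"
    using sets_image_in_sets[OF refl noise_measurable] .
  moreover have "sets (past t) \<subseteq> events"
    using subalgebra_past by (simp add: subalgebra_def)
  moreover have "prob (a \<inter> b) = prob a * prob b" if "a \<in> sets (past t)" "b \<in> sets ?E" for a b
    using that prob_past_noise by (auto simp: sets_vimage_algebra2)
  ultimately have "indep_set (sets (past t)) (sets ?E)"
    by (simp add: indep_sets2_eq)
  then have "indep_set (sigma_sets (space M) {U -` A \<inter> space M |A. A \<in> sets borel})
      (sigma_sets (space M) {(\<lambda>\<omega>. f (\<epsilon> t \<omega>)) -` A \<inter> space M |A. A \<in> sets borel})"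
    using U' F' unfolding indep_sets2_eq by (meson subset_iff)
  moreover have "random_variable borel U"
    using U subalgebra_past by (rule measurable_from_subalg[rotated])
  moreover have "random_variable borel (\<lambda>\<omega>. f (\<epsilon> t \<omega>))"
    using noise_measurable f by (rule measurable_compose)
  ultimately show ?thesis
    by (simp add: indep_var_eq)
qed

end

section \<open>Concentration of the quadratic form\<close>

lemma space_pow_borel: "space (pow_borel p S) = pow_set p S"
  by (auto simp: pow_borel_def space_restrict_space space_PiM)

text \<open>Positive definiteness says nothing about measurability; joint measurability comes from
  the expansion, whose partial sums are measurable and converge pointwise.\<close>

lemma kernel_measurable:
  fixes k :: "(nat \<Rightarrow> 'a::topological_space) \<Rightarrow> (nat \<Rightarrow> 'a) \<Rightarrow> real"
  assumes \<phi>: "\<And>n j. j \<in> J n \<Longrightarrow> \<phi> n j \<in> borel_measurable (pow_borel p S)"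
    and k: "\<And>x y. x \<in> pow_set p S \<Longrightarrow> y \<in> pow_set p S \<Longrightarrow>
      (\<lambda>n. c n * (\<Sum>j\<in>J n. \<phi> n j x * \<phi> n j y)) sums k x y"
  shows "(\<lambda>z. k (fst z) (snd z)) \<in> borel_measurable (pow_borel p S \<Otimes>\<^sub>M pow_borel p S)"
proof -
  have meas: "(\<lambda>z. \<Sum>n. c n * (\<Sum>j\<in>J n. \<phi> n j (fst z) * \<phi> n j (snd z))) \<in>
      borel_measurable (pow_borel p S \<Otimes>\<^sub>M pow_borel p S)"
    by (intro borel_measurable_suminf borel_measurable_times borel_measurable_const
        borel_measurable_sum measurable_compose[OF measurable_fst \<phi>]
        measurable_compose[OF measurable_snd \<phi>])
  have eq: "(\<Sum>n. c n * (\<Sum>j\<in>J n. \<phi> n j (fst z) * \<phi> n j (snd z))) = k (fst z) (snd z)"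
    if "z \<in> space (pow_borel p S \<Otimes>\<^sub>M pow_borel p S)" for z
    using that k[THEN sums_unique] by (auto simp: space_pair_measure space_pow_borel)
  show ?thesis
    by (rule measurable_cong[OF eq, THEN iffD1, OF _ meas])
qed

context nonlinear_var
begin

lemma lagvec_in: "\<omega> \<in> space M \<Longrightarrow> lagvec p X t \<omega> \<in> pow_set p S"
  using X_in by (auto simp: lagvec_def)

lemma lagvec_measurable:
  assumes "space N = space M" and "\<And>s. s \<le> t \<Longrightarrow> X s \<in> borel_measurable N"
  shows "lagvec p X t \<in> N \<rightarrow>\<^sub>M pow_borel p S"
  unfolding pow_borel_def
proof (rule measurable_restrict_space2)
  show "lagvec p X t \<in> space N \<rightarrow> pow_set p S"
    using assms lagvec_in by auto
  have "(\<lambda>\<omega>. \<lambda>j\<in>{..<p}. X (t - int j) \<omega>) \<in> N \<rightarrow>\<^sub>M PiM {..<p} (\<lambda>_. borel)"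
    using assms by (intro measurable_restrict) simp
  then show "lagvec p X t \<in> N \<rightarrow>\<^sub>M PiM {..<p} (\<lambda>_. borel)"
    by (simp add: lagvec_def[abs_def])
qed

text \<open>The squared RKHS norm of the \<open>i\<close>-th martingale after \<open>m\<close>
  steps. Index \<open>a\<close> stands for time \<open>p + 1 + a\<close>, so the kernel sees the lag
  vector one time earlier. Counting from 0 permits induction on \<open>m\<close>.\<close>

definition comp_quad :: "((nat \<Rightarrow> real ^ 'd) \<Rightarrow> (nat \<Rightarrow> real ^ 'd) \<Rightarrow> real) \<Rightarrow> 'd \<Rightarrow> nat \<Rightarrow> 'w \<Rightarrow> real" where
  "comp_quad k i m \<omega> = (\<Sum>a<m. \<Sum>b<m.
     \<epsilon> (int p + 1 + int a) \<omega> $ i * \<epsilon> (int p + 1 + int b) \<omega> $ i *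
     k (lagvec p X (int p + int a) \<omega>) (lagvec p X (int p + int b) \<omega>))"

lemma noise_quad_eq_comp_quad:
  assumes "p < T"
  shows "noise_quad p K X \<epsilon> T \<omega> = (\<Sum>i\<in>UNIV. comp_quad (K i) i (T - p) \<omega>)"
proof -
  have reindex: "(\<Sum>s\<in>{int p + 1..int T}. f s) = (\<Sum>a<T - p. f (int p + 1 + int a))"
    for f :: "int \<Rightarrow> real"
    by (rule sum.reindex_bij_witness[of _ "\<lambda>a. int p + 1 + int a" "\<lambda>s. nat (s - int p - 1)"])
      (use assms in auto)
  have shift: "int p + 1 + int a - 1 = int p + int a" for a
    by simp
  show ?thesis
    unfolding noise_quad_eq comp_quad_def reindex shift by (simp add: mult_ac)
qed

section \<open>Exponential moments and tails for a single component\<close>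

context
  fixes k :: "(nat \<Rightarrow> real ^ 'd) \<Rightarrow> (nat \<Rightarrow> real ^ 'd) \<Rightarrow> real" and i :: 'd and \<kappa> v :: real
  assumes spd: "spd_kernel (pow_set p S) k"
    and k_measurable: "(\<lambda>z. k (fst z) (snd z)) \<in> borel_measurable (pow_borel p S \<Otimes>\<^sub>M pow_borel p S)"
    and k_bound: "\<And>x. x \<in> pow_set p S \<Longrightarrow> k x x \<le> \<kappa>\<^sup>2" and \<kappa>: "0 < \<kappa>"
    and subg: "\<And>t. subgaussian M v (\<lambda>\<omega>. \<epsilon> t \<omega> $ i)"
begin

lemma kernel_lagvec_measurable:
  assumes "s < t" "s' < t"
  shows "(\<lambda>\<omega>. k (lagvec p X s \<omega>) (lagvec p X s' \<omega>)) \<in> borel_measurable (past t)"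
proof -
  have "lagvec p X r \<in> past t \<rightarrow>\<^sub>M pow_borel p S" if "r < t" for r
    using that by (intro lagvec_measurable space_past past_measurable_X) auto
  then have "(\<lambda>\<omega>. (lagvec p X s \<omega>, lagvec p X s' \<omega>)) \<in> past t \<rightarrow>\<^sub>M pow_borel p S \<Otimes>\<^sub>M pow_borel p S"
    using assms by (intro measurable_Pair)
  from measurable_compose[OF this k_measurable] show ?thesis
    by simp
qed

lemma noise_comp_measurable: "s < t \<Longrightarrow> (\<lambda>\<omega>. \<epsilon> s \<omega> $ i) \<in> borel_measurable (past t)"
  by (intro measurable_compose[OF past_measurable_noise borel_measurable_nth])

text \<open>After \<open>m\<close> steps the latest noise has time \<open>p + m\<close>, just before
  the noise of the next step.\<close>

lemma comp_quad_measurable_past: "comp_quad k i m \<in> borel_measurable (past (int p + 1 + int m))"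
proof -
  have "(\<lambda>\<omega>. comp_quad k i m \<omega>) \<in> borel_measurable (past (int p + 1 + int m))"
    unfolding comp_quad_def
    by (intro borel_measurable_sum borel_measurable_times noise_comp_measurable
        kernel_lagvec_measurable) auto
  then show ?thesis .
qed

lemma comp_quad_measurable: "comp_quad k i m \<in> borel_measurable M"
  using subalgebra_past comp_quad_measurable_past by (rule measurable_from_subalg)

text \<open>Induction on the number of steps: each new noise variable, independent of the past,
  multiplies the bound by \<open>exp (v * (l * \<kappa>)\<^sup>2)\<close>. Integrability is carried
  along because factorising the expectations requires it.\<close>

lemma comp_quad_cosh:
  assumes l: "0 \<le> l"
  shows "integrable M (\<lambda>\<omega>. cosh (l * sqrt (comp_quad k i m \<omega>)))"
    and "expectation (\<lambda>\<omega>. cosh (l * sqrt (comp_quad k i m \<omega>))) \<le> exp (real m * (v * (l * \<kappa>)\<^sup>2))"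
proof (induction m)
  case 0
  {
    case 1
    show ?case by (simp add: comp_quad_def)
  next
    case 2
    show ?case by (simp add: comp_quad_def prob_space)
  }
next
  case (Suc m)
  define t where "t = int p + 1 + int m"
  define Q where "Q = comp_quad k i m"
  define e where "e = (\<lambda>\<omega>. \<epsilon> t \<omega> $ i)"
  \<comment> \<open>The newest argument \<open>y m\<close> is the lag vector at time
    \<open>t - 1\<close>, so it still belongs to the past of \<open>t\<close>.\<close>
  define y where "y = (\<lambda>a \<omega>. lagvec p X (int p + int a) \<omega>)"
  define B where "B = (\<lambda>\<omega>. \<Sum>a<m. \<epsilon> (int p + 1 + int a) \<omega> $ i * k (y a \<omega>) (y m \<omega>))"
  define U where "U = (\<lambda>\<omega>. cosh (l * sqrt (Q \<omega>)))"
  define V where "V = (\<lambda>\<omega>. B \<omega> / (sqrt (Q \<omega>) * \<kappa>) * sinh (l * sqrt (Q \<omega>)))"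
  define C where "C = (\<lambda>\<omega>. cosh (l * \<kappa> * e \<omega>))"
  define D where "D = (\<lambda>\<omega>. sinh (l * \<kappa> * e \<omega>))"
  define W where "W = (\<lambda>\<omega>. cosh (l * sqrt (comp_quad k i (Suc m) \<omega>)))"
  have Q_meas: "Q \<in> borel_measurable (past t)"
    using comp_quad_measurable_past[of m] by (simp add: Q_def t_def)
  have B_meas: "B \<in> borel_measurable (past t)"
    unfolding B_def y_def t_def
    by (intro borel_measurable_sum borel_measurable_times noise_comp_measurable
        kernel_lagvec_measurable) auto
  have sqrtQ: "(\<lambda>\<omega>. sqrt (Q \<omega>)) \<in> borel_measurable (past t)"
    using Q_meas by measurable
  have cosh_meas: "cosh \<in> borel_measurable (borel :: real measure)"
    and sinh_meas: "sinh \<in> borel_measurable (borel :: real measure)"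
    by (auto intro!: borel_measurable_continuous_onI continuous_intros)
  have U_meas: "U \<in> borel_measurable (past t)"
    unfolding U_def using sqrtQ
    by (intro measurable_compose[OF _ cosh_meas] borel_measurable_times) auto
  have V_meas: "V \<in> borel_measurable (past t)"
    unfolding V_def using sqrtQ B_meas
    by (intro borel_measurable_times borel_measurable_divide measurable_compose[OF _ sinh_meas]) auto
  \<comment> \<open>Pathwise form of \<open>cosh_norm_perturb\<close>: \<open>U\<close> and
    \<open>V\<close> depend on the past, \<open>C\<close> and \<open>D\<close> only on the new
    noise.\<close>
  have step: "\<bar>B \<omega> / (sqrt (Q \<omega>) * \<kappa>)\<bar> \<le> 1" "W \<omega> \<le> U \<omega> * C \<omega> + V \<omega> * D \<omega>"
    if \<omega>: "\<omega> \<in> space M" for \<omega>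
  proof -
    note cs = spd_kernel_cauchy_schwarz[OF spd, of m "\<lambda>a. y a \<omega>" "\<lambda>a. \<epsilon> (int p + 1 + int a) \<omega> $ i"]
    have y: "y a \<omega> \<in> pow_set p S" for a
      unfolding y_def using \<omega> by (rule lagvec_in)
    have Q: "0 \<le> Q \<omega>" "(B \<omega>)\<^sup>2 \<le> Q \<omega> * k (y m \<omega>) (y m \<omega>)"
      using cs(1,4)[OF y] by (auto simp: Q_def comp_quad_def y_def B_def)
    have Suc_eq: "comp_quad k i (Suc m) \<omega> = Q \<omega> + 2 * e \<omega> * B \<omega> + (e \<omega>)\<^sup>2 * k (y m \<omega>) (y m \<omega>)"
      using cs(2)[OF y] by (simp only: Q_def comp_quad_def y_def B_def e_def t_def)
    have nonneg: "0 \<le> Q \<omega> + 2 * e \<omega> * B \<omega> + (e \<omega>)\<^sup>2 * k (y m \<omega>) (y m \<omega>)"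
      using cs(3)[OF y] unfolding Suc_eq[symmetric] by (simp only: comp_quad_def y_def)
    note perturb = cosh_norm_perturb[OF Q k_bound[OF y] \<kappa> l nonneg]
    show "\<bar>B \<omega> / (sqrt (Q \<omega>) * \<kappa>)\<bar> \<le> 1"
      by (rule perturb)
    show "W \<omega> \<le> U \<omega> * C \<omega> + V \<omega> * D \<omega>"
      using perturb(2) unfolding W_def U_def V_def C_def D_def Suc_eq by simp
  qed
  have abs_V: "\<bar>V \<omega>\<bar> \<le> U \<omega>" if "\<omega> \<in> space M" for \<omega>
  proof -
    have "\<bar>V \<omega>\<bar> \<le> 1 * \<bar>sinh (l * sqrt (Q \<omega>))\<bar>"
      unfolding V_def abs_mult using step(1)[OF that] by (intro mult_right_mono) auto
    also have "\<dots> \<le> U \<omega>"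
      unfolding U_def using sinh_le_cosh_real[of "l * sqrt (Q \<omega>)"] sinh_le_cosh_real[of "- (l * sqrt (Q \<omega>))"]
      by (simp add: abs_le_iff)
    finally show ?thesis .
  qed
  have U_int: "integrable M U" and U_le: "expectation U \<le> exp (real m * (v * (l * \<kappa>)\<^sup>2))"
    using Suc.IH by (simp_all add: U_def Q_def)
  have V_int: "integrable M V"
    using U_int measurable_from_subalg[OF subalgebra_past V_meas]
  proof (rule Bochner_Integration.integrable_bound)
    show "AE \<omega> in M. norm (V \<omega>) \<le> norm (U \<omega>)"
      using abs_V by (intro AE_I2) (auto intro: order_trans[OF _ abs_ge_self])
  qed
  have e_int: "integrable M e"
    unfolding e_def using noise_integrable by (rule integrable_bounded_linear[OF bounded_linear_vec_nth])
  have e_mean: "expectation e = 0"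
    unfolding e_def using integral_bounded_linear[OF bounded_linear_vec_nth[of i] noise_integrable[of t]]
    by (simp add: noise_mean)
  have CD: "integrable M C" "integrable M D" "expectation C + \<bar>expectation D\<bar> \<le> exp (v * (l * \<kappa>)\<^sup>2)"
    using subgaussian_cosh_sinh[of v e "l * \<kappa>"] subg[of t] e_int e_mean
    by (simp_all add: C_def D_def e_def)
  have "indep_var borel U borel C" "indep_var borel V borel D"
    unfolding C_def D_def e_def
    by (intro indep_var_past_noise U_meas V_meas borel_measurable_continuous_onI continuous_intros)+
  then have prod: "integrable M (\<lambda>\<omega>. U \<omega> * C \<omega>)" "integrable M (\<lambda>\<omega>. V \<omega> * D \<omega>)"
    "expectation (\<lambda>\<omega>. U \<omega> * C \<omega>) = expectation U * expectation C"
    "expectation (\<lambda>\<omega>. V \<omega> * D \<omega>) = expectation V * expectation D"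
    using U_int V_int CD by (auto intro: indep_var_integrable indep_var_lebesgue_integral)
  have sum_int: "integrable M (\<lambda>\<omega>. U \<omega> * C \<omega> + V \<omega> * D \<omega>)"
    using prod by auto
  have W_meas: "W \<in> borel_measurable M"
    unfolding W_def using comp_quad_measurable
    by (intro measurable_compose[OF _ cosh_meas] borel_measurable_times borel_measurable_sqrt) auto
  have W_int: "integrable M W"
    using sum_int W_meas
  proof (rule Bochner_Integration.integrable_bound)
    show "AE \<omega> in M. norm (W \<omega>) \<le> norm (U \<omega> * C \<omega> + V \<omega> * D \<omega>)"
      using step(2) by (intro AE_I2) (auto simp: W_def intro: order_trans[OF _ abs_ge_self])
  qed
  have "expectation W \<le> expectation (\<lambda>\<omega>. U \<omega> * C \<omega> + V \<omega> * D \<omega>)"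
    using W_int sum_int step(2) by (rule integral_mono)
  also have "\<dots> = expectation U * expectation C + expectation V * expectation D"
    using prod by simp
  \<comment> \<open>The sign of the second product is unknown; \<open>\<bar>V\<bar> \<le> U\<close>
    lets \<open>expectation U\<close> be factored out.\<close>
  also have "\<dots> \<le> expectation U * expectation C + expectation U * \<bar>expectation D\<bar>"
  proof -
    have "expectation V * expectation D \<le> \<bar>expectation V\<bar> * \<bar>expectation D\<bar>"
      by (metis abs_ge_self abs_mult)
    moreover have "\<bar>expectation V\<bar> \<le> expectation (\<lambda>\<omega>. \<bar>V \<omega>\<bar>)"
      by (rule integral_abs_bound)
    moreover have "expectation (\<lambda>\<omega>. \<bar>V \<omega>\<bar>) \<le> expectation U"
      using V_int U_int abs_V by (intro integral_mono) auto
    ultimately have "expectation V * expectation D \<le> expectation U * \<bar>expectation D\<bar>"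
      by (meson abs_ge_zero mult_right_mono order_trans)
    then show ?thesis
      by simp
  qed
  also have "expectation U * expectation C + expectation U * \<bar>expectation D\<bar> =
      expectation U * (expectation C + \<bar>expectation D\<bar>)"
    by (simp add: distrib_left)
  also have "\<dots> \<le> exp (real m * (v * (l * \<kappa>)\<^sup>2)) * exp (v * (l * \<kappa>)\<^sup>2)"
    using U_le CD(3) by (intro mult_mono') (auto simp: U_def C_def intro!: integral_nonneg_AE add_nonneg_nonneg)
  also have "\<dots> = exp (real (Suc m) * (v * (l * \<kappa>)\<^sup>2))"
    by (simp add: exp_add[symmetric] algebra_simps)
  finally have W_le: "expectation W \<le> exp (real (Suc m) * (v * (l * \<kappa>)\<^sup>2))" .
  {
    case 1
    show ?case using W_int by (simp add: W_def)
  next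
    case 2
    show ?case using W_le by (simp add: W_def)
  }
qed

text \<open>Markov's inequality for \<open>cosh\<close>; the factor 2 comes from
  \<open>cosh x \<ge> exp x / 2\<close>. The parameter \<open>l\<close> stays free for later
  optimisation.\<close>

lemma comp_quad_tail:
  assumes l: "0 \<le> l" and r: "0 \<le> r"
  shows "prob {\<omega> \<in> space M. r\<^sup>2 \<le> comp_quad k i m \<omega>} \<le> 2 * exp (real m * (v * (l * \<kappa>)\<^sup>2) - l * r)"
proof -
  let ?W = "\<lambda>\<omega>. cosh (l * sqrt (comp_quad k i m \<omega>))"
  have W_ge: "{\<omega> \<in> space M. r\<^sup>2 \<le> comp_quad k i m \<omega>} \<subseteq> {\<omega> \<in> space M. exp (l * r) / 2 \<le> ?W \<omega>}"
  proof safe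
    fix \<omega> assume "r\<^sup>2 \<le> comp_quad k i m \<omega>"
    then have "l * r \<le> l * sqrt (comp_quad k i m \<omega>)"
      using l by (intro mult_left_mono real_le_rsqrt)
    then have "exp (l * r) \<le> exp (l * sqrt (comp_quad k i m \<omega>))"
      by simp
    also have "\<dots> \<le> 2 * ?W \<omega>"
      by (simp add: cosh_def)
    finally show "exp (l * r) / 2 \<le> ?W \<omega>"
      by simp
  qed
  have int: "integrable M ?W"
    using l by (rule comp_quad_cosh)
  have "prob {\<omega> \<in> space M. r\<^sup>2 \<le> comp_quad k i m \<omega>} \<le> prob {\<omega> \<in> space M. exp (l * r) / 2 \<le> ?W \<omega>}"
    using W_ge borel_measurable_integrable[OF int] by (intro finite_measure_mono) measurable
  also have "\<dots> \<le> expectation ?W / (exp (l * r) / 2)"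
    using int by (intro integral_Markov_inequality_measure[where A = "{}"]) auto
  also have "\<dots> \<le> exp (real m * (v * (l * \<kappa>)\<^sup>2)) / (exp (l * r) / 2)"
    using comp_quad_cosh(2)[OF l] by (intro divide_right_mono) auto
  also have "\<dots> = 2 * exp (real m * (v * (l * \<kappa>)\<^sup>2) - l * r)"
    by (simp add: exp_diff)
  finally show ?thesis .
qed

end

end

text \<open>If the sum of the component forms exceeds \<open>T\<^sup>2 * \<delta>\<^sup>2\<close>,
  some component reaches the share \<open>1 / d\<close> of it, where \<open>d\<close> is the
  dimension; a union bound over components finishes.\<close>

lemma (in nonlinear_var) noise_quad_tail:
  fixes K :: "'d \<Rightarrow> (nat \<Rightarrow> real ^ 'd) \<Rightarrow> (nat \<Rightarrow> real ^ 'd) \<Rightarrow> real"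
  assumes spd: "\<And>i. spd_kernel (pow_set p S) (K i)"
    and K_measurable: "\<And>i. (\<lambda>z. K i (fst z) (snd z)) \<in>
      borel_measurable (pow_borel p S \<Otimes>\<^sub>M pow_borel p S)"
    and K_bound: "\<And>i x. x \<in> pow_set p S \<Longrightarrow> K i x x \<le> \<kappa>\<^sup>2" and \<kappa>: "0 < \<kappa>"
    and subg: "\<And>i t. subgaussian M v (\<lambda>\<omega>. \<epsilon> t \<omega> $ i)" and v: "0 < v"
    and T: "p < T"
  shows "noise_quad p K X \<epsilon> T \<in> borel_measurable M"
    and "0 < \<delta> \<Longrightarrow> prob {\<omega> \<in> space M. 1 / (real T)\<^sup>2 * noise_quad p K X \<epsilon> T \<omega> > \<delta>\<^sup>2}
      \<le> 2 * real CARD('d) * exp (- (1 / (4 * real CARD('d) * v * \<kappa>\<^sup>2)) * (real T * \<delta>\<^sup>2))"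
proof -
  let ?d = "real CARD('d)"
  note meas = comp_quad_measurable[OF spd K_measurable K_bound \<kappa> subg]
  have "(\<lambda>\<omega>. noise_quad p K X \<epsilon> T \<omega>) \<in> borel_measurable M"
    unfolding noise_quad_eq_comp_quad[OF T] using meas by (intro borel_measurable_sum)
  then show "noise_quad p K X \<epsilon> T \<in> borel_measurable M"
    by simp
  assume \<delta>: "0 < \<delta>"
  have d: "0 < ?d" and T0: "0 < real T"
    using T by auto
  define r where "r = real T * \<delta> / sqrt ?d"
  \<comment> \<open>The minimiser of \<open>T * v * (l * \<kappa>)\<^sup>2 - l * r\<close>, with the
    step count \<open>T - p\<close> enlarged to \<open>T\<close>.\<close>
  define l where "l = \<delta> / (2 * sqrt ?d * v * \<kappa>\<^sup>2)"
  define A where "A = (\<lambda>i. {\<omega> \<in> space M. r\<^sup>2 \<le> comp_quad (K i) i (T - p) \<omega>})"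
  have r: "0 \<le> r" and r2: "?d * r\<^sup>2 = (real T)\<^sup>2 * \<delta>\<^sup>2" and l: "0 \<le> l"
    using d \<delta> v by (auto simp: r_def l_def power_divide power_mult_distrib)
  have A: "A i \<in> events" for i
    unfolding A_def using meas[of i] by measurable
  have "{\<omega> \<in> space M. 1 / (real T)\<^sup>2 * noise_quad p K X \<epsilon> T \<omega> > \<delta>\<^sup>2} \<subseteq> (\<Union>i\<in>UNIV. A i)"
  proof safe
    fix \<omega> assume \<omega>: "\<omega> \<in> space M" and gt: "1 / (real T)\<^sup>2 * noise_quad p K X \<epsilon> T \<omega> > \<delta>\<^sup>2"
    show "\<omega> \<in> (\<Union>i\<in>UNIV. A i)"
    proof (rule ccontr)
      assume "\<omega> \<notin> (\<Union>i\<in>UNIV. A i)"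
      then have "comp_quad (K i) i (T - p) \<omega> \<le> r\<^sup>2" for i
        using \<omega> by (auto simp: A_def not_le less_imp_le)
      then have "noise_quad p K X \<epsilon> T \<omega> \<le> (\<Sum>i\<in>(UNIV::'d set). r\<^sup>2)"
        unfolding noise_quad_eq_comp_quad[OF T] by (rule sum_mono)
      with gt T0 r2 show False
        by (simp add: field_simps)
    qed
  qed
  then have "prob {\<omega> \<in> space M. 1 / (real T)\<^sup>2 * noise_quad p K X \<epsilon> T \<omega> > \<delta>\<^sup>2} \<le> prob (\<Union>i\<in>UNIV. A i)"
    using A by (intro finite_measure_mono) auto
  also have "\<dots> \<le> (\<Sum>i\<in>UNIV. prob (A i))"
    using A by (intro finite_measure_subadditive_finite) auto
  also have "\<dots> \<le> (\<Sum>i\<in>(UNIV::'d set). 2 * exp (real (T - p) * (v * (l * \<kappa>)\<^sup>2) - l * r))"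
    unfolding A_def
    by (intro sum_mono comp_quad_tail[OF spd K_measurable K_bound \<kappa> subg l r])
  also have "\<dots> \<le> (\<Sum>i\<in>(UNIV::'d set). 2 * exp (real T * (v * (l * \<kappa>)\<^sup>2) - l * r))"
    using v by (intro sum_mono) (auto intro!: mult_right_mono)
  also have "real T * (v * (l * \<kappa>)\<^sup>2) - l * r = - (1 / (4 * ?d * v * \<kappa>\<^sup>2)) * (real T * \<delta>\<^sup>2)"
  proof -
    have lk: "(l * \<kappa>)\<^sup>2 = \<delta>\<^sup>2 / (4 * ?d * v\<^sup>2 * \<kappa>\<^sup>2)"
      using d \<kappa> v by (simp add: l_def power_mult_distrib power_divide field_simps power2_eq_square)
    have lr: "l * r = real T * \<delta>\<^sup>2 / (2 * (sqrt ?d * sqrt ?d) * v * \<kappa>\<^sup>2)"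
      by (simp add: l_def r_def power2_eq_square mult_ac del: real_sqrt_mult_self)
    show ?thesis
      unfolding lk lr using d \<kappa> v by (simp add: field_simps power2_eq_square)
  qed
  finally show "prob {\<omega> \<in> space M. 1 / (real T)\<^sup>2 * noise_quad p K X \<epsilon> T \<omega> > \<delta>\<^sup>2}
      \<le> 2 * ?d * exp (- (1 / (4 * ?d * v * \<kappa>\<^sup>2)) * (real T * \<delta>\<^sup>2))"
    by simp
qed

section \<open>Comparison of the tail exponent with the required rates\<close>

lemma c1_rate_nonneg: "0 \<le> c1_rate d b1 b2 \<sigma> T \<delta> \<gamma> L"
  by (simp add: c1_rate_def)

text \<open>Since \<open>L powr b2 \<ge> 1\<close>, both nonnegative terms of the squared difference
  are bounded independently of \<open>T\<close> and \<open>L\<close>, which leaves linear growth in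
  \<open>T\<close>.\<close>

lemma c1_rate_le:
  assumes "0 < d" "0 < b1" "0 \<le> b2" "1 \<le> L" "1 \<le> T" "0 \<le> \<delta>" "0 \<le> \<sigma>"
  shows "c1_rate d b1 b2 \<sigma> T \<delta> \<gamma> L \<le>
    real T * (((\<delta> * (real d * b1) powr (- 1 / 2))\<^sup>2 + \<sigma>\<^sup>2) / \<gamma>\<^sup>2)"
proof -
  define x where "x = \<delta> * (real d * b1 * real L powr b2) powr (- 1 / 2)"
  define y where "y = \<sigma> / sqrt (real T)"
  have xy: "0 \<le> x" "0 \<le> y"
    using assms by (auto simp: x_def y_def)
  have "real d * b1 * 1 \<le> real d * b1 * real L powr b2"
    using assms by (intro mult_left_mono ge_one_powr_ge_zero) auto
  then have "x \<le> \<delta> * (real d * b1) powr (- 1 / 2)"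
    unfolding x_def using assms by (intro mult_left_mono powr_mono2') auto
  moreover have "y \<le> \<sigma>"
    unfolding y_def using assms by (simp add: divide_le_eq mult_le_cancel_left1)
  moreover have "(x - y)\<^sup>2 \<le> x\<^sup>2 + y\<^sup>2"
    using xy by (simp add: power2_diff)
  ultimately have "(x - y)\<^sup>2 \<le> (\<delta> * (real d * b1) powr (- 1 / 2))\<^sup>2 + \<sigma>\<^sup>2"
    using xy by (meson add_mono order_trans power_mono)
  then have "real T / \<gamma>\<^sup>2 * (x - y)\<^sup>2 \<le> real T / \<gamma>\<^sup>2 * ((\<delta> * (real d * b1) powr (- 1 / 2))\<^sup>2 + \<sigma>\<^sup>2)"
    by (intro mult_left_mono) auto
  then show ?thesis
    by (simp add: c1_rate_def x_def y_def)
qed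

text \<open>For large \<open>T\<close> the rate \<open>a T\<close> dominates \<open>c r\<^sub>1 T\<close>; for the finitely many remaining \<open>T\<close>, the
  first summand can be pushed above \<open>1 - exp (- r\<^sub>2 T)\<close> by making \<open>c\<close> small.\<close>

lemma exp_rate_absorb:
  fixes P r1 r2 :: "nat \<Rightarrow> real"
  assumes P: "\<And>T. m < T \<Longrightarrow> P T \<le> 2 * d * exp (- a * real T)" "\<And>T. P T \<le> 1"
    and r1: "\<And>T. m < T \<Longrightarrow> 0 \<le> r1 T" "\<And>T. m < T \<Longrightarrow> r1 T \<le> real T * C"
    and pos: "0 < a" "0 < C" "1 \<le> d"
  shows "\<exists>c>0. \<forall>T>m. P T \<le> d * exp (- c * r1 T) + d * exp (- r2 T)"
proof -
  \<comment> \<open>From \<open>n\<close> on, half of the rate absorbs the factor 2: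
    \<open>2 * exp (- a * T) \<le> exp (- a * T / 2)\<close>.\<close>
  obtain n where n: "2 * ln 2 / a \<le> real n"
    using real_arch_simple by blast
  define \<epsilon> where "\<epsilon> = Min ((\<lambda>T. exp (- r2 T)) ` {..n})"
  have \<epsilon>: "0 < \<epsilon>" "\<And>T. T \<le> n \<Longrightarrow> \<epsilon> \<le> exp (- r2 T)"
    by (auto simp: \<epsilon>_def)
  \<comment> \<open>The first bound gives \<open>c * r1 T \<le> a * T / 2\<close> for large
    \<open>T\<close>, the second \<open>c * r1 T \<le> \<epsilon>\<close> for small
    \<open>T\<close>.\<close>
  define c where "c = min (a / (2 * C)) (\<epsilon> / ((real n + 1) * C))"
  have nC: "0 < (real n + 1) * C"
    using pos by simp
  have "c \<le> a / (2 * C)" "c \<le> \<epsilon> / ((real n + 1) * C)"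
    by (simp_all add: c_def)
  moreover have "0 < c"
    unfolding c_def using pos \<epsilon>(1) nC by simp
  ultimately have c: "0 < c" "c * C \<le> a / 2" "c * C * (real n + 1) \<le> \<epsilon>"
    using pos nC by (simp_all add: pos_le_divide_eq mult_ac)
  have "P T \<le> d * exp (- c * r1 T) + d * exp (- r2 T)" if T: "m < T" for T
  proof (cases "n \<le> T")
    case True
    have cr: "c * r1 T \<le> real T * (a / 2)"
    proof -
      have "c * r1 T \<le> c * (real T * C)"
        using r1(2)[OF T] c by (intro mult_left_mono) auto
      also have "\<dots> = real T * (c * C)"
        by simp
      also have "\<dots> \<le> real T * (a / 2)"
        using c by (intro mult_left_mono) auto
      finally show ?thesis .
    qed
    have "2 * ln 2 / a \<le> real T"
      using n True by simp
    then have "ln 2 \<le> real T * (a / 2)"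
      using pos by (simp add: field_simps)
    then have "ln 2 + - a * real T \<le> - c * r1 T"
      using cr by (simp add: field_simps)
    then have "exp (ln 2 + - a * real T) \<le> exp (- c * r1 T)"
      by (simp only: exp_le_cancel_iff)
    then have "2 * exp (- a * real T) \<le> exp (- c * r1 T)"
      unfolding exp_add by simp
    then have "d * (2 * exp (- a * real T)) \<le> d * exp (- c * r1 T)"
      using pos by (intro mult_left_mono) auto
    moreover have "0 \<le> d * exp (- r2 T)"
      using pos by simp
    ultimately show ?thesis
      using P(1)[OF T] by (simp add: mult_ac)
  next
    case False
    have "c * r1 T \<le> c * (real T * C)"
      using r1(2)[OF T] c by (intro mult_left_mono) auto
    also have "\<dots> \<le> c * C * (real n + 1)"
      using False c(1) pos by (simp add: mult_ac)
    also have "\<dots> \<le> exp (- r2 T)"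
      using c(3) \<epsilon>(2)[of T] False by simp
    finally have "1 \<le> (1 + - c * r1 T) + exp (- r2 T)"
      by simp
    also have "\<dots> \<le> exp (- c * r1 T) + exp (- r2 T)"
      by (intro add_right_mono exp_ge_add_one_self)
    also have "\<dots> \<le> d * (exp (- c * r1 T) + exp (- r2 T))"
      using pos mult_right_mono[of 1 d "exp (- c * r1 T) + exp (- r2 T)"] by simp
    finally show ?thesis
      using P(2)[of T] by (simp add: distrib_left)
  qed
  with c show ?thesis
    by blast
qed

text \<open>A single nonnegative term lies below every partial sum with \<open>m \<ge> k\<close>,
  and the bound on these tends to 0.\<close>

lemma beta_growth_negative_exponent:
  fixes f :: "nat \<Rightarrow> 'a \<Rightarrow> real"
  assumes f: "\<And>k j. 0 \<le> f k j"
    and growth: "\<And>m. 1 \<le> m \<Longrightarrow> (\<Sum>k=1..m. \<Sum>j\<in>J k. f k j) \<le> b1 * real m powr b2"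
    and b2: "b2 < 0" and kj: "1 \<le> k" "j \<in> J k" "finite (J k)"
  shows "f k j = 0"
proof -
  have "f k j \<le> b1 * real m powr b2" if "k \<le> m" for m
  proof -
    have "f k j \<le> (\<Sum>j\<in>J k. f k j)"
      using f kj by (intro member_le_sum) auto
    also have "\<dots> \<le> (\<Sum>k=1..m. \<Sum>j\<in>J k. f k j)"
      using f kj that by (intro member_le_sum[of k "{1..m}"] sum_nonneg) auto
    also have "\<dots> \<le> b1 * real m powr b2"
      using that kj by (intro growth) auto
    finally show ?thesis .
  qed
  moreover have "(\<lambda>m. b1 * real m powr b2) \<longlonglongrightarrow> b1 * 0"
    using b2 by (intro tendsto_mult tendsto_const tendsto_neg_powr filterlim_real_sequentially)
  ultimately have "f k j \<le> b1 * 0"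
    by (intro LIMSEQ_le_const) auto
  with f[of k j] show ?thesis
    by simp
qed

text \<open>As \<open>enn2real\<close> sends \<open>\<top>\<close> to 0 too, finiteness is what
  makes the supremum itself vanish.\<close>

lemma sup_norm_eq_0D:
  fixes f :: "'a \<Rightarrow> 'b::euclidean_space"
  assumes "enn2real (sup_norm A f) = 0" "sup_norm A f < \<top>" "x \<in> A"
  shows "f x = 0"
proof -
  have "sup_norm A f = 0"
    using assms by (auto simp: enn2real_eq_0_iff)
  then have "ennreal (infnorm (f x)) \<le> 0"
    using assms by (metis SUP_upper sup_norm_def)
  then show ?thesis
    using infnorm_pos_le[of "f x"] by (simp add: infnorm_eq_0 ennreal_eq_0_iff)
qed

section \<open>Both probability bounds, split by the sign of \<open>b2\<close>\<close>

theorem theorem3p3: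
  fixes M :: "'w measure"
    and S :: "(real ^ 'd) set"
    and p :: nat
    and g :: "(nat \<Rightarrow> real ^ 'd) \<Rightarrow> real ^ 'd"
    and X \<epsilon> :: "int \<Rightarrow> 'w \<Rightarrow> real ^ 'd"
    and K :: "'d \<Rightarrow> (nat \<Rightarrow> real ^ 'd) \<Rightarrow> (nat \<Rightarrow> real ^ 'd) \<Rightarrow> real"
    and M_g :: real
    and \<kappa> :: "'d \<Rightarrow> real"
    and ev :: "'d \<Rightarrow> nat \<Rightarrow> real"
    and \<phi> :: "'d \<Rightarrow> nat \<Rightarrow> nat \<Rightarrow> (nat \<Rightarrow> real ^ 'd) \<Rightarrow> real"
    and N :: "nat \<Rightarrow> nat"
    and b1 b2 :: real
    and \<alpha> :: "nat \<Rightarrow> real"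
    and \<beta>1 \<beta>2 :: real
    and MT :: "nat \<Rightarrow> nat"
    and \<sigma>i :: "'d \<Rightarrow> real"
    and \<sigma> :: real
  assumes model: "nonlinear_var M S p g X \<epsilon>"
    and kernel: "\<And>i. spd_kernel (pow_set p S) (K i)"
    and g_bound: "0 < M_g" "sup_norm (pow_set p S) g \<le> ennreal M_g"
    and kappa: "\<And>i. 0 < \<kappa> i"
      "\<And>i. (SUP x\<in>pow_set p S. ennreal \<bar>K i x x\<bar>) \<le> ennreal ((\<kappa> i)\<^sup>2)"
    and N_def: "\<And>k. N k = mult_num (CARD('d) * p) k"
    and ev_nonneg: "\<And>i k. 1 \<le> k \<Longrightarrow> 0 \<le> ev i k"
    and phi_measurable: "\<And>i j k. 1 \<le> k \<Longrightarrow> j \<in> {1..N k} \<Longrightarrow>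
      \<phi> i j k \<in> borel_measurable (pow_borel p S)"
    and phi_bounded: "\<And>i j k. 1 \<le> k \<Longrightarrow> j \<in> {1..N k} \<Longrightarrow>
      sup_norm (pow_set p S) (\<phi> i j k) < \<top>"
    and expansion: "\<And>i x y. x \<in> pow_set p S \<Longrightarrow> y \<in> pow_set p S \<Longrightarrow>
      (\<lambda>k. ev i (Suc k) * (\<Sum>j=1..N (Suc k). \<phi> i j (Suc k) x * \<phi> i j (Suc k) y)) sums K i x y"
    and b1: "0 < b1"
    and beta_growth: "\<And>i m. 1 \<le> m \<Longrightarrow>
      (\<Sum>k=1..m. \<Sum>j=1..N k.
         (sqrt (ev i k) * enn2real (sup_norm (pow_set p S) (\<phi> i j k)))\<^sup>2) \<le> b1 * real m powr b2"
    and alpha_summable: "summable (\<lambda>k. \<bar>\<alpha> k\<bar>)"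
    and alpha_bound: "\<And>i k t. 1 \<le> k \<Longrightarrow> int p + 1 \<le> t \<Longrightarrow>
      ev i k * (\<Sum>j=1..N k. \<integral>\<omega>. (\<phi> i j k (lagvec p X (t - 1) \<omega>))\<^sup>2 \<partial>M) \<le> \<alpha> k"
    and beta12: "0 < \<beta>1" "0 < \<beta>2"
    and MT_pos: "\<And>T. 1 \<le> T \<Longrightarrow> 1 \<le> MT T"
    and MT_mono: "mono_on {1..} MT"
    and alpha_tail: "\<And>T. 1 \<le> T \<Longrightarrow> (\<Sum>k. \<alpha> (k + MT T)) \<le> \<beta>1 * real T powr (- \<beta>2)"
    and sigma_pos: "\<And>i. 0 < \<sigma>i i"
    and noise_subgaussian: "\<And>t i. subgaussian M ((\<sigma>i i)\<^sup>2) (\<lambda>\<omega>. \<epsilon> t \<omega> $ i)"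
    and noise_density: "\<And>t i. has_density_bounded_below M (\<lambda>\<omega>. \<epsilon> t \<omega> $ i)"
    and sigma_def: "\<sigma> = sqrt (Max (range (\<lambda>i. (\<sigma>i i)\<^sup>2)))"
  shows
    "(\<forall>\<delta>>0. \<forall>\<gamma>>0. \<exists>c>0. \<forall>T>p.
        measure M {\<omega> \<in> space M. 1 / (real T)\<^sup>2 * noise_quad p K X \<epsilon> T \<omega> > \<delta>\<^sup>2}
        \<le> real CARD('d) * exp (- c * c1_rate CARD('d) b1 b2 \<sigma> T \<delta> \<gamma> (MT T))
          + real CARD('d) * exp (- c2_rate CARD('d) \<sigma> T \<gamma>)
          + 2 * (real CARD('d))\<^sup>2 * \<sigma>\<^sup>2 / (\<delta>\<^sup>2 * real T) * (\<beta>1 * real T powr (- \<beta>2)))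
     \<and>
     (\<exists>c0>0. \<exists>c1>0. \<exists>c2>0. \<forall>T>p. \<forall>\<delta>>0. \<forall>\<gamma>>0.
        \<delta> \<ge> c0 * sqrt (ln (real T) / real T) * real (MT T) powr (b2 / 2) * \<gamma> \<longrightarrow>
        \<gamma> \<ge> sqrt (4 * \<sigma>\<^sup>2 * ln (real (CARD('d) * T))) \<longrightarrow>
        measure M {\<omega> \<in> space M. 1 / (real T)\<^sup>2 * noise_quad p K X \<epsilon> T \<omega> \<le> \<delta>\<^sup>2}
        \<ge> 1 - c1 * real T powr (- c2))"
proof -
  interpret nonlinear_var M S p g X \<epsilon>
    by (rule model)
  let ?d = "real CARD('d)"
  define P where "P = (\<lambda>\<delta> T. prob {\<omega> \<in> space M. 1 / (real T)\<^sup>2 * noise_quad p K X \<epsilon> T \<omega> > \<delta>\<^sup>2})"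
  have \<sigma>2: "\<sigma>\<^sup>2 = Max (range (\<lambda>i. (\<sigma>i i)\<^sup>2))" and \<sigma>: "0 < \<sigma>"
  proof -
    have "0 < (\<sigma>i i)\<^sup>2" for i
      using sigma_pos[of i] by simp
    then have "0 < Max (range (\<lambda>i. (\<sigma>i i)\<^sup>2))"
      by (subst Max_gr_iff) auto
    then show "\<sigma>\<^sup>2 = Max (range (\<lambda>i. (\<sigma>i i)\<^sup>2))" "0 < \<sigma>"
      by (simp_all add: sigma_def)
  qed
  \<comment> \<open>Enlarging a variance proxy weakens the condition, so all components share
    \<open>\<sigma>\<^sup>2\<close>.\<close>
  have subg: "subgaussian M (\<sigma>\<^sup>2) (\<lambda>\<omega>. \<epsilon> t \<omega> $ i)" for t i
  proof -
    have le: "(\<sigma>i i)\<^sup>2 \<le> \<sigma>\<^sup>2"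
      unfolding \<sigma>2 by (rule Max_ge) auto
    then have "exp ((\<sigma>i i)\<^sup>2 * u\<^sup>2 / 2) \<le> exp (\<sigma>\<^sup>2 * u\<^sup>2 / 2)" for u
      by (simp add: mult_right_mono)
    then show ?thesis
      using noise_subgaussian[of i t] unfolding subgaussian_def by (meson order_trans)
  qed
  define \<kappa>m where "\<kappa>m = Max (range \<kappa>)"
  have \<kappa>_le: "\<kappa> i \<le> \<kappa>m" for i
    unfolding \<kappa>m_def by (rule Max_ge) auto
  then have \<kappa>m: "0 < \<kappa>m"
    using kappa(1) less_le_trans by blast
  have K_bound: "K i x x \<le> \<kappa>m\<^sup>2" if "x \<in> pow_set p S" for i x
  proof -
    have "ennreal \<bar>K i x x\<bar> \<le> ennreal ((\<kappa> i)\<^sup>2)"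
      using kappa(2)[of i] SUP_upper[OF that, of "\<lambda>x. ennreal \<bar>K i x x\<bar>"] by (rule order_trans[rotated])
    then have "K i x x \<le> (\<kappa> i)\<^sup>2"
      by simp
    also have "\<dots> \<le> \<kappa>m\<^sup>2"
      using \<kappa>_le[of i] kappa(1)[of i] by (intro power_mono) auto
    finally show ?thesis .
  qed
  have K_measurable: "(\<lambda>z. K i (fst z) (snd z)) \<in>
      borel_measurable (pow_borel p S \<Otimes>\<^sub>M pow_borel p S)" for i
  proof (rule kernel_measurable)
    show "\<phi> i j (Suc n) \<in> borel_measurable (pow_borel p S)" if "j \<in> {1..N (Suc n)}" for n j
      using that by (intro phi_measurable) auto
  qed (rule expansion)
  define a where "a = 1 / (4 * ?d * \<sigma>\<^sup>2 * \<kappa>m\<^sup>2)"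
  have a: "0 < a"
    using \<sigma> \<kappa>m by (simp add: a_def)
  have \<sigma>2_pos: "0 < \<sigma>\<^sup>2"
    using \<sigma> by simp
  have noise_quad_measurable: "noise_quad p K X \<epsilon> T \<in> borel_measurable M" if "p < T" for T
    using kernel K_measurable K_bound \<kappa>m subg \<sigma>2_pos that by (rule noise_quad_tail(1))
  have tail: "P \<delta> T \<le> 2 * ?d * exp (- a * (real T * \<delta>\<^sup>2))" if "p < T" "0 < \<delta>" for \<delta> T
    unfolding P_def a_def
    using kernel K_measurable K_bound \<kappa>m subg \<sigma>2_pos that by (rule noise_quad_tail(2))
  have compl: "prob {\<omega> \<in> space M. 1 / (real T)\<^sup>2 * noise_quad p K X \<epsilon> T \<omega> \<le> \<delta>\<^sup>2} = 1 - P \<delta> T"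
    if "p < T" for \<delta> T
  proof -
    have "{\<omega> \<in> space M. 1 / (real T)\<^sup>2 * noise_quad p K X \<epsilon> T \<omega> > \<delta>\<^sup>2} \<in> events"
      using noise_quad_measurable[OF that] by measurable
    from prob_neg[OF this] show ?thesis
      by (simp add: P_def not_less)
  qed
  have P_eq_0: "P \<delta> T = 0" if "b2 < 0" "p < T" for \<delta> T
  proof -
    have term_0: "ev i k * (\<phi> i j k x * \<phi> i j k y) = 0"
      if k: "1 \<le> k" "j \<in> {1..N k}" and x: "x \<in> pow_set p S" for i j k x y
    proof -
      have "(sqrt (ev i k) * enn2real (sup_norm (pow_set p S) (\<phi> i j k)))\<^sup>2 = 0"
        by (rule beta_growth_negative_exponent[OF _ beta_growth[of _ i] \<open>b2 < 0\<close> k]) simp_all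
      \<comment> \<open>Either the eigenvalue is zero or the eigenfunction vanishes on the whole
        set; both annihilate the term.\<close>
      then show ?thesis
        using sup_norm_eq_0D[OF _ phi_bounded[OF k] x, of i] by auto
    qed
    have "K i x y = 0" if xy: "x \<in> pow_set p S" "y \<in> pow_set p S" for i x y
    proof -
      have "ev i (Suc k) * (\<Sum>j=1..N (Suc k). \<phi> i j (Suc k) x * \<phi> i j (Suc k) y) = 0" for k
        unfolding sum_distrib_left by (intro sum.neutral ballI term_0 xy) auto
      then have "(\<lambda>k. 0) sums K i x y"
        using expansion[OF xy, of i] by (simp only:)
      then show ?thesis
        using sums_0 sums_unique2 by blast
    qed
    then have "noise_quad p K X \<epsilon> T \<omega> = 0" if "\<omega> \<in> space M" for \<omega>
      using that lagvec_in by (simp add: noise_quad_eq)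
    then have "{\<omega> \<in> space M. 1 / (real T)\<^sup>2 * noise_quad p K X \<epsilon> T \<omega> > \<delta>\<^sup>2} = {}"
      by auto
    then show ?thesis
      unfolding P_def by (simp only: measure_empty)
  qed
  have part1: "\<exists>c>0. \<forall>T>p. P \<delta> T
      \<le> ?d * exp (- c * c1_rate CARD('d) b1 b2 \<sigma> T \<delta> \<gamma> (MT T)) + ?d * exp (- c2_rate CARD('d) \<sigma> T \<gamma>)
        + 2 * ?d\<^sup>2 * \<sigma>\<^sup>2 / (\<delta>\<^sup>2 * real T) * (\<beta>1 * real T powr (- \<beta>2))"
    if \<delta>: "0 < \<delta>" and \<gamma>: "0 < \<gamma>" for \<delta> \<gamma>
  proof -
    \<comment> \<open>This summand is nonnegative, so it may be added to a bound by the two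
      exponentials.\<close>
    have rest: "0 \<le> 2 * ?d\<^sup>2 * \<sigma>\<^sup>2 / (\<delta>\<^sup>2 * real T) * (\<beta>1 * real T powr (- \<beta>2))" for T
      using beta12 by simp
    have "\<exists>c>0. \<forall>T>p. P \<delta> T \<le> ?d * exp (- c * c1_rate CARD('d) b1 b2 \<sigma> T \<delta> \<gamma> (MT T))
        + ?d * exp (- c2_rate CARD('d) \<sigma> T \<gamma>)"
    proof (cases "b2 < 0")
      case True
      have "P \<delta> T \<le> ?d * exp (- 1 * c1_rate CARD('d) b1 b2 \<sigma> T \<delta> \<gamma> (MT T))
          + ?d * exp (- c2_rate CARD('d) \<sigma> T \<gamma>)" if "p < T" for T
        using P_eq_0[OF True that, of \<delta>] by (simp add: add_nonneg_nonneg)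
      then show ?thesis
        using zero_less_one by blast
    next
      case False
      show ?thesis
      proof (rule exp_rate_absorb[where a = "a * \<delta>\<^sup>2"
            and C = "((\<delta> * (?d * b1) powr (- 1 / 2))\<^sup>2 + \<sigma>\<^sup>2) / \<gamma>\<^sup>2"])
        show "P \<delta> T \<le> 2 * ?d * exp (- (a * \<delta>\<^sup>2) * real T)" if "p < T" for T
          using tail[OF that \<delta>] by (simp add: mult_ac)
        show "P \<delta> T \<le> 1" for T
          unfolding P_def by (rule prob_le_1)
        show "c1_rate CARD('d) b1 b2 \<sigma> T \<delta> \<gamma> (MT T)
            \<le> real T * (((\<delta> * (?d * b1) powr (- 1 / 2))\<^sup>2 + \<sigma>\<^sup>2) / \<gamma>\<^sup>2)" if "p < T" for T
          using False b1 \<delta> \<sigma> that by (intro c1_rate_le MT_pos) auto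
        show "0 < ((\<delta> * (?d * b1) powr (- 1 / 2))\<^sup>2 + \<sigma>\<^sup>2) / \<gamma>\<^sup>2"
          using \<gamma> \<sigma> by (intro divide_pos_pos add_nonneg_pos) auto
        show "1 \<le> ?d"
          by (simp add: Suc_le_eq)
      qed (use a \<delta> c1_rate_nonneg in auto)
    qed
    then show ?thesis
      using rest by (meson add_increasing2)
  qed
  \<comment> \<open>With \<open>c0 = 1\<close> and \<open>MT T powr (b2 / 2) \<ge> 1\<close>, the
    conditions give \<open>T * \<delta>\<^sup>2 \<ge> ln T * \<gamma>\<^sup>2\<close> and
    \<open>\<gamma>\<^sup>2 \<ge> 4 * \<sigma>\<^sup>2 * ln 2\<close>, as
    \<open>d * T \<ge> 2\<close> for the dimension \<open>d\<close>. Inserted in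
    \<open>tail\<close>, this yields the power of \<open>T\<close>.\<close>
  have part2: "1 - (2 * ?d) * real T powr (- (a * (4 * \<sigma>\<^sup>2 * ln 2))) \<le> 1 - P \<delta> T"
    if T: "p < T" and \<delta>: "0 < \<delta>" and \<gamma>: "0 < \<gamma>"
      and \<delta>_ge: "\<delta> \<ge> 1 * sqrt (ln (real T) / real T) * real (MT T) powr (b2 / 2) * \<gamma>"
      and \<gamma>_ge: "\<gamma> \<ge> sqrt (4 * \<sigma>\<^sup>2 * ln (real (CARD('d) * T)))" for T \<delta> \<gamma>
  proof (cases "b2 < 0")
    case True
    then show ?thesis
      using P_eq_0[OF True T] by simp
  next
    case False
    have T2: "2 \<le> T"
      using T p_pos by simp
    have "1 \<le> real (MT T) powr (b2 / 2)"
      using MT_pos[of T] T2 False by (intro ge_one_powr_ge_zero) auto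
    then have "sqrt (ln (real T) / real T) * 1 * \<gamma> \<le> \<delta>"
      using T2 \<gamma> by (intro order_trans[OF _ \<delta>_ge] mult_right_mono mult_left_mono) auto
    then have "(sqrt (ln (real T) / real T) * \<gamma>)\<^sup>2 \<le> \<delta>\<^sup>2"
      using T2 \<gamma> by (intro power_mono) auto
    then have \<delta>2: "ln (real T) * \<gamma>\<^sup>2 \<le> real T * \<delta>\<^sup>2"
      using T2 by (simp add: power_mult_distrib field_simps)
    have "2 * 1 \<le> real T * ?d"
      using T2 by (intro mult_mono) (auto simp: Suc_le_eq)
    then have "ln 2 \<le> ln (real (CARD('d) * T))"
      using T2 by (subst ln_le_cancel_iff) (auto simp: mult_ac)
    then have "4 * \<sigma>\<^sup>2 * ln 2 \<le> 4 * \<sigma>\<^sup>2 * ln (real (CARD('d) * T))"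
      by (intro mult_left_mono) auto
    also have "\<dots> \<le> \<gamma>\<^sup>2"
      using \<gamma>_ge by (rule sqrt_le_D)
    finally have "ln (real T) * (4 * \<sigma>\<^sup>2 * ln 2) \<le> ln (real T) * \<gamma>\<^sup>2"
      using T2 by (intro mult_left_mono) auto
    with \<delta>2 have "a * (ln (real T) * (4 * \<sigma>\<^sup>2 * ln 2)) \<le> a * (real T * \<delta>\<^sup>2)"
      using a by (intro mult_left_mono) auto
    then have "exp (- a * (real T * \<delta>\<^sup>2)) \<le> real T powr (- (a * (4 * \<sigma>\<^sup>2 * ln 2)))"
      using T2 by (simp add: powr_def mult_ac)
    then have "2 * ?d * exp (- a * (real T * \<delta>\<^sup>2)) \<le> 2 * ?d * real T powr (- (a * (4 * \<sigma>\<^sup>2 * ln 2)))"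
      by (intro mult_left_mono) auto
    from order_trans[OF tail[OF T \<delta>] this] show ?thesis
      by simp
  qed
  show ?thesis
  proof (intro conjI)
    show "\<forall>\<delta>>0. \<forall>\<gamma>>0. \<exists>c>0. \<forall>T>p.
        prob {\<omega> \<in> space M. 1 / (real T)\<^sup>2 * noise_quad p K X \<epsilon> T \<omega> > \<delta>\<^sup>2}
        \<le> ?d * exp (- c * c1_rate CARD('d) b1 b2 \<sigma> T \<delta> \<gamma> (MT T))
          + ?d * exp (- c2_rate CARD('d) \<sigma> T \<gamma>)
          + 2 * ?d\<^sup>2 * \<sigma>\<^sup>2 / (\<delta>\<^sup>2 * real T) * (\<beta>1 * real T powr (- \<beta>2))"
      using part1 unfolding P_def by blast
    have pos: "0 < 2 * ?d" "0 < a * (4 * \<sigma>\<^sup>2 * ln 2)"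
      using a \<sigma> by simp_all
    show "\<exists>c0>0. \<exists>c1>0. \<exists>c2>0. \<forall>T>p. \<forall>\<delta>>0. \<forall>\<gamma>>0.
        \<delta> \<ge> c0 * sqrt (ln (real T) / real T) * real (MT T) powr (b2 / 2) * \<gamma> \<longrightarrow>
        \<gamma> \<ge> sqrt (4 * \<sigma>\<^sup>2 * ln (real (CARD('d) * T))) \<longrightarrow>
        prob {\<omega> \<in> space M. 1 / (real T)\<^sup>2 * noise_quad p K X \<epsilon> T \<omega> \<le> \<delta>\<^sup>2}
        \<ge> 1 - c1 * real T powr (- c2)"
    proof (rule exI[of _ 1], rule conjI[OF zero_less_one], rule exI[of _ "2 * ?d"],
        rule conjI[OF pos(1)], rule exI[of _ "a * (4 * \<sigma>\<^sup>2 * ln 2)"], rule conjI[OF pos(2)],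
        intro allI impI)
      fix T \<delta> \<gamma>
      assume T: "p < T" and *: "0 < \<delta>" "0 < \<gamma>"
        "\<delta> \<ge> 1 * sqrt (ln (real T) / real T) * real (MT T) powr (b2 / 2) * \<gamma>"
        "\<gamma> \<ge> sqrt (4 * \<sigma>\<^sup>2 * ln (real (CARD('d) * T)))"
      show "prob {\<omega> \<in> space M. 1 / (real T)\<^sup>2 * noise_quad p K X \<epsilon> T \<omega> \<le> \<delta>\<^sup>2}
          \<ge> 1 - 2 * ?d * real T powr (- (a * (4 * \<sigma>\<^sup>2 * ln 2)))"
        unfolding compl[OF T] using T * by (rule part2)
    qed
  qed
qed

end
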